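(* Let $\Omega\subset\mathbb{R}^2$ be a bounded domain with Lipschitz boundary, let $\sigma\in(-1,1]$, and if $\sigma=1$ assume in addition that $\Omega$ satisfies a uniform external ball condition. Let $p>1$ and $g\in L^1(\Omega)$ with $g>0$ in $\Omega$. If $u\in\mathcal{N}_\sigma$ satisfies $J_\sigma(u)=\inf_{v\in\mathcal{N}_\sigma}J_\sigma(v)$, then $u$ is a critical point of $J_\sigma$ on $H^2(\Omega)\cap H^1_0(\Omega)$.
   Context: $J_\sigma:H^2(\Omega)\cap H^1_0(\Omega)\to\mathbb{R}$, $J_\sigma(u)=\int_\Omega\frac{(\Delta u)^2}{2}-(1-\sigma)\int_\Omega\det(\nabla^2u)-\int_\Omega\frac{g(x)|u|^{p+1}}{p+1}$, a $C^1$ functional. The Nehari manifold is $\mathcal{N}_\sigma=\{u\in (H^2(\Omega)\cap H^1_0(\Omega))\setminus\{0\}: J_\sigma'(u)[u]=0\}$. $\Omega$ satisfies a uniform external ball condition if there is $R>0$ such that for every $x\in\partial\Omega$ there is a ball $B_R$ of radius $R$ with $x\in\partial B_R$ and $B_R\subset\mathbb{R}^2\setminus\overline\Omega$. *)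

theory Defs
  imports "HOL-Analysis.Analysis"
begin

text \<open>Functions on the plane are modelled as maps real^2 => real; Sobolev
  functions are represented by (arbitrary) representatives, integrals are
  Lebesgue integrals over the domain.\<close>

type_synonym pfun = "real^2 \<Rightarrow> real"

definition pd :: "2 \<Rightarrow> pfun \<Rightarrow> pfun" where
  "pd i f = (\<lambda>x. frechet_derivative f (at x) (axis i 1))"

fun Ck :: "nat \<Rightarrow> pfun \<Rightarrow> bool" where
  "Ck 0 f = continuous_on UNIV f"
| "Ck (Suc n) f = (f differentiable_on UNIV \<and> continuous_on UNIV f \<and> (\<forall>i. Ck n (pd i f)))"

definition smooth :: "pfun \<Rightarrow> bool" where
  "smooth f \<longleftrightarrow> (\<forall>n. Ck n f)"

definition test_fun :: "(real^2) set \<Rightarrow> pfun \<Rightarrow> bool" where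
  "test_fun \<Omega> \<phi> \<longleftrightarrow> smooth \<phi> \<and> compact (closure {x. \<phi> x \<noteq> 0})
      \<and> closure {x. \<phi> x \<noteq> 0} \<subseteq> \<Omega>"

definition L2 :: "(real^2) set \<Rightarrow> pfun \<Rightarrow> bool" where
  "L2 \<Omega> u \<longleftrightarrow> u \<in> borel_measurable (lebesgue_on \<Omega>)
      \<and> integrable (lebesgue_on \<Omega>) (\<lambda>x. (u x)^2)"

definition weak_d1 :: "(real^2) set \<Rightarrow> pfun \<Rightarrow> 2 \<Rightarrow> pfun \<Rightarrow> bool" where
  "weak_d1 \<Omega> u i w \<longleftrightarrow> (\<forall>\<phi>. test_fun \<Omega> \<phi> \<longrightarrow>
      integral\<^sup>L (lebesgue_on \<Omega>) (\<lambda>x. u x * pd i \<phi> x)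
      = - integral\<^sup>L (lebesgue_on \<Omega>) (\<lambda>x. w x * \<phi> x))"

definition weak_d2 :: "(real^2) set \<Rightarrow> pfun \<Rightarrow> 2 \<Rightarrow> 2 \<Rightarrow> pfun \<Rightarrow> bool" where
  "weak_d2 \<Omega> u i j w \<longleftrightarrow> (\<forall>\<phi>. test_fun \<Omega> \<phi> \<longrightarrow>
      integral\<^sup>L (lebesgue_on \<Omega>) (\<lambda>x. u x * pd i (pd j \<phi>) x)
      = integral\<^sup>L (lebesgue_on \<Omega>) (\<lambda>x. w x * \<phi> x))"

definition H1 :: "(real^2) set \<Rightarrow> pfun \<Rightarrow> bool" where
  "H1 \<Omega> u \<longleftrightarrow> L2 \<Omega> u \<and> (\<forall>i. \<exists>w. L2 \<Omega> w \<and> weak_d1 \<Omega> u i w)"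

definition H2 :: "(real^2) set \<Rightarrow> pfun \<Rightarrow> bool" where
  "H2 \<Omega> u \<longleftrightarrow> H1 \<Omega> u \<and> (\<forall>i j. \<exists>w. L2 \<Omega> w \<and> weak_d2 \<Omega> u i j w)"

definition H10 :: "(real^2) set \<Rightarrow> pfun \<Rightarrow> bool" where
  "H10 \<Omega> u \<longleftrightarrow> H1 \<Omega> u \<and> (\<exists>w :: 2 \<Rightarrow> pfun. (\<forall>i. L2 \<Omega> (w i) \<and> weak_d1 \<Omega> u i (w i)) \<and>
      (\<exists>\<phi> :: nat \<Rightarrow> pfun. (\<forall>n. test_fun \<Omega> (\<phi> n)) \<and>
        (\<lambda>n. integral\<^sup>L (lebesgue_on \<Omega>) (\<lambda>x. (u x - \<phi> n x)^2)
            + (\<Sum>i\<in>UNIV. integral\<^sup>L (lebesgue_on \<Omega>) (\<lambda>x. (w i x - pd i (\<phi> n) x)^2)))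
        \<longlonglongrightarrow> 0))"

definition Xsp :: "(real^2) set \<Rightarrow> pfun set" where
  "Xsp \<Omega> = {u. H2 \<Omega> u \<and> H10 \<Omega> u}"

text \<open>Weak second derivative (unique a.e.; the integrals below do not depend on the choice).\<close>
definition D2 :: "(real^2) set \<Rightarrow> pfun \<Rightarrow> 2 \<Rightarrow> 2 \<Rightarrow> pfun" where
  "D2 \<Omega> u i j = (SOME w. L2 \<Omega> w \<and> weak_d2 \<Omega> u i j w)"

definition J :: "(real^2) set \<Rightarrow> real \<Rightarrow> pfun \<Rightarrow> real \<Rightarrow> pfun \<Rightarrow> real" where
  "J \<Omega> \<sigma> g p u =
     integral\<^sup>L (lebesgue_on \<Omega>) (\<lambda>x. (D2 \<Omega> u 1 1 x + D2 \<Omega> u 2 2 x)^2 / 2)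
     - (1 - \<sigma>) * integral\<^sup>L (lebesgue_on \<Omega>)
          (\<lambda>x. D2 \<Omega> u 1 1 x * D2 \<Omega> u 2 2 x - D2 \<Omega> u 1 2 x * D2 \<Omega> u 2 1 x)
     - integral\<^sup>L (lebesgue_on \<Omega>) (\<lambda>x. g x * \<bar>u x\<bar> powr (p + 1) / (p + 1))"

text \<open>J'(u)[v] = 0, via the directional derivative of t |-> J(u + t v) at 0
  (J is C^1, so this is the Frechet derivative applied to v).\<close>
definition dJ_zero :: "(real^2) set \<Rightarrow> real \<Rightarrow> pfun \<Rightarrow> real \<Rightarrow> pfun \<Rightarrow> pfun \<Rightarrow> bool" where
  "dJ_zero \<Omega> \<sigma> g p u v \<longleftrightarrow>
     ((\<lambda>t. J \<Omega> \<sigma> g p (\<lambda>x. u x + t * v x)) has_real_derivative 0) (at 0)"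

definition Nehari :: "(real^2) set \<Rightarrow> real \<Rightarrow> pfun \<Rightarrow> real \<Rightarrow> pfun set" where
  "Nehari \<Omega> \<sigma> g p = {u \<in> Xsp \<Omega>. \<not> (AE x in lebesgue_on \<Omega>. u x = 0) \<and> dJ_zero \<Omega> \<sigma> g p u u}"

definition critical_point :: "(real^2) set \<Rightarrow> real \<Rightarrow> pfun \<Rightarrow> real \<Rightarrow> pfun \<Rightarrow> bool" where
  "critical_point \<Omega> \<sigma> g p u \<longleftrightarrow> u \<in> Xsp \<Omega> \<and> (\<forall>v\<in>Xsp \<Omega>. dJ_zero \<Omega> \<sigma> g p u v)"

definition lipschitz_boundary :: "(real^2) set \<Rightarrow> bool" where
  "lipschitz_boundary \<Omega> \<longleftrightarrow> (\<forall>x0\<in>frontier \<Omega>. \<exists>r>0. \<exists>R L \<gamma>.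
      orthogonal_transformation (R :: real^2 \<Rightarrow> real^2) \<and> (L::real)-lipschitz_on UNIV (\<gamma> :: real \<Rightarrow> real) \<and>
      \<Omega> \<inter> ball x0 r = {x \<in> ball x0 r. R (x - x0) $ 2 < \<gamma> (R (x - x0) $ 1)})"

definition uniform_ext_ball :: "(real^2) set \<Rightarrow> bool" where
  "uniform_ext_ball \<Omega> \<longleftrightarrow> (\<exists>R>0. \<forall>x\<in>frontier \<Omega>. \<exists>c.
      x \<in> sphere c R \<and> ball c R \<subseteq> - closure \<Omega>)"

end

theory Submission
  imports Defs
begin

text \<open>On a Nehari function \<open>w\<close> the functional is \<open>\<tau>\<^sup>2 Q(w) - \<tau>\<^sup>p\<^sup>+\<^sup>1 P(w)\<close> along the ray
  \<open>\<tau> w\<close>, with \<open>Q\<close> quadratic and \<open>P(w) = \<integral> g |w|\<^sup>p\<^sup>+\<^sup>1 / (p + 1)\<close>, and it is stationary at \<open>\<tau> = 1\<close>.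
  Since \<open>Q(u), P(u) > 0\<close>, each line \<open>u + s v\<close> can be projected radially onto the Nehari manifold
  for small \<open>s\<close>; minimality of \<open>u\<close> and stationarity in \<open>\<tau>\<close> give \<open>Q'(u)[v] = P'(u)[v]\<close>.

  Because \<open>g\<close> is merely integrable, \<open>P\<close> is finite and differentiable only if functions with second
  weak derivatives in \<open>L\<^sup>2\<close> are bounded. Near every point of the closure there is a parallelogram
  which stays in \<open>\<Omega>\<close> when its corner is moved to any nearby \<open>x \<in> \<Omega>\<close>. Testing the weak derivatives,
  in the two directions of its sides, against products of one-dimensional ramps that rise at \<open>x\<close>
  bounds the averages of \<open>u\<close> over small parallelograms with corner \<open>x\<close> uniformly, and Lebesgue
  differentiation turns this into an essential bound.\<close>

subsection \<open>Smooth functions on the line\<close>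

text \<open>Why second derivatives in the plane give boundedness: the value of a function at a
  corner is, up to lower-order terms, the integral of its mixed second derivative over a
  parallelogram. So integrability of one mixed derivative, along the two sides, is enough. The weak
  form of this uses ramps of height at most a constant times \<open>t\<close> in each direction. Two
  of them contribute \<open>t^2\<close>, which is the order of the area of the small parallelogram,
  and so the bound on averages is uniform in \<open>t\<close>. A second obstacle is that
  \<open>D2\<close> is an arbitrary choice among weak derivatives, hence linear only almost
  everywhere. That requires uniqueness of weak derivatives, which comes from the same Lebesgue
  differentiation argument with the bound 0. All test functions are products of functions of one
  linear coordinate each, so smoothness in the plane reduces to smoothness on the line. Criticality
  is tested along one line at a time, so the whole variational argument takes place for two real
  functions \<open>A\<close> and \<open>B\<close> of one variable.\<close>

primrec cd :: "nat \<Rightarrow> (real \<Rightarrow> real) \<Rightarrow> bool" where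
  "cd 0 f \<longleftrightarrow> continuous_on UNIV f"
| "cd (Suc n) f \<longleftrightarrow> (\<forall>x. f field_differentiable at x) \<and> cd n (deriv f)"

definition smooth1 :: "(real \<Rightarrow> real) \<Rightarrow> bool" where
  "smooth1 f \<longleftrightarrow> (\<forall>n. cd n f)"

lemma cd_SucI:
  assumes "\<And>x. (f has_real_derivative f' x) (at x)" "cd n f'"
  shows "cd (Suc n) f"
proof -
  have "deriv f = f'" using assms(1) by (auto intro!: DERIV_imp_deriv)
  then show ?thesis using assms by (auto simp: field_differentiable_def)
qed

lemma cd_Suc_imp: "cd (Suc n) f \<Longrightarrow> cd n f"
proof (induction n arbitrary: f)
  case 0
  then have "f differentiable_on UNIV"
    by (auto simp: differentiable_on_def field_differentiable_imp_differentiable)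
  then show ?case by (simp add: differentiable_imp_continuous_on)
next
  case (Suc n)
  then show ?case by (meson cd.simps(2))
qed

lemma cd_const: "cd n (\<lambda>x. c)"
proof (induction n arbitrary: c)
  case (Suc n)
  show ?case by (rule cd_SucI[where f'="\<lambda>x. 0"]) (auto simp: Suc)
qed auto

lemma cd_has_deriv: "cd (Suc n) f \<Longrightarrow> (f has_real_derivative deriv f x) (at x)"
  by (simp add: field_differentiable_derivI)

lemma cd_add: "cd n f \<Longrightarrow> cd n g \<Longrightarrow> cd n (\<lambda>x. f x + g x)"
proof (induction n arbitrary: f g)
  case (Suc n)
  show ?case
    by (rule cd_SucI[where f'="\<lambda>x. deriv f x + deriv g x"])
       (use Suc in \<open>auto intro!: derivative_eq_intros cd_has_deriv\<close>)
qed (auto intro: continuous_intros)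

lemma cd_mult: "cd n f \<Longrightarrow> cd n g \<Longrightarrow> cd n (\<lambda>x. f x * g x)"
proof (induction n arbitrary: f g)
  case (Suc n)
  show ?case
    by (rule cd_SucI[where f'="\<lambda>x. deriv f x * g x + deriv g x * f x"])
       (use Suc cd_Suc_imp[of n f] cd_Suc_imp[of n g] in
         \<open>auto intro!: derivative_eq_intros cd_has_deriv cd_add\<close>)
qed (auto intro: continuous_intros)

lemma cd_affine: "cd n f \<Longrightarrow> cd n (\<lambda>x. f (m * x + c))"
proof (induction n arbitrary: f)
  case 0
  then show ?case
    by (auto intro!: continuous_on_compose2[of UNIV f] continuous_intros)
next
  case (Suc n)
  show ?case
  proof (rule cd_SucI[where f'="\<lambda>x. deriv f (m * x + c) * m"])
    show "((\<lambda>x. f (m * x + c)) has_real_derivative deriv f (m * x + c) * m) (at x)" for x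
      by (rule DERIV_chain2[OF cd_has_deriv[OF Suc.prems]]) (auto intro!: derivative_eq_intros)
    show "cd n (\<lambda>x. deriv f (m * x + c) * m)"
      using Suc by (auto intro!: cd_mult cd_const)
  qed
qed

lemma smooth1_mult: "smooth1 f \<Longrightarrow> smooth1 g \<Longrightarrow> smooth1 (\<lambda>x. f x * g x)"
  by (simp add: smooth1_def cd_mult)

lemma smooth1_add: "smooth1 f \<Longrightarrow> smooth1 g \<Longrightarrow> smooth1 (\<lambda>x. f x + g x)"
  by (simp add: smooth1_def cd_add)

lemma smooth1_const: "smooth1 (\<lambda>x. c)"
  by (simp add: smooth1_def cd_const)

lemma smooth1_cmult: "smooth1 f \<Longrightarrow> smooth1 (\<lambda>x. c * f x)"
  by (simp add: smooth1_mult smooth1_const)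

lemma smooth1_diff: "smooth1 f \<Longrightarrow> smooth1 g \<Longrightarrow> smooth1 (\<lambda>x. f x - g x)"
  using smooth1_add[of f "\<lambda>x. (-1) * g x"] smooth1_cmult[of g "-1"] by simp

lemma smooth1_affine: "smooth1 f \<Longrightarrow> smooth1 (\<lambda>x. f (m * x + c))"
  by (simp add: smooth1_def cd_affine)

lemma smooth1_continuous: "smooth1 f \<Longrightarrow> continuous_on S f"
  using continuous_on_subset[of UNIV f S] by (auto simp: smooth1_def dest: spec[of _ 0])

lemma smooth1_deriv: "smooth1 f \<Longrightarrow> smooth1 (deriv f)"
  by (metis cd.simps(2) smooth1_def)

lemma smooth1_has_deriv: "smooth1 f \<Longrightarrow> (f has_real_derivative deriv f x) (at x)"
  by (meson cd_has_deriv smooth1_def)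

text \<open>Gives smoothness of functions defined by integration, where no closed form is
  available.\<close>

lemma smooth1_antideriv:
  assumes "\<And>x. (f has_real_derivative f' x) (at x)" "smooth1 f'"
  shows "smooth1 f"
  unfolding smooth1_def
proof
  fix n show "cd n f"
    using cd_Suc_imp cd_SucI[OF assms(1)] assms(2) by (auto simp: smooth1_def)
qed

section \<open>A flat function and one-dimensional bumps\<close>

definition exp_step :: "real \<Rightarrow> real" where
  "exp_step x = (if x > 0 then exp (- 1 / x) else 0)"

text \<open>The substitution \<open>1 / x\<close> turns this into decay of polynomials against the
  exponential at infinity. General polynomials are required because every derivative of
  \<open>exp_step\<close> has this form.\<close>

lemma poly_exp_tendsto_0:
  "((\<lambda>x. poly P (1 / x) * exp (- 1 / x)) \<longlongrightarrow> 0) (at_right (0::real))"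
proof -
  have "((\<lambda>x. poly P x * exp (- x)) \<longlongrightarrow> 0) at_top" for P :: "real poly"
  proof (induction P)
    case (pCons a P)
    have "((\<lambda>x::real. a * exp (-x)) \<longlongrightarrow> a * 0) at_top"
      by (intro tendsto_mult tendsto_const) (auto intro: filterlim_compose[OF exp_at_bot] filterlim_uminus_at_bot_at_top)
    moreover have "((\<lambda>x. x * (poly P x * exp (- x))) \<longlongrightarrow> 0) at_top"
    proof -
      have "((\<lambda>x::real. \<Sum>i\<le>degree P. coeff P i * (x ^ Suc i / exp x)) \<longlongrightarrow> (\<Sum>i\<le>degree P. coeff P i * 0)) at_top"
        by (intro tendsto_sum tendsto_mult tendsto_const tendsto_power_div_exp_0)
      moreover have "(\<lambda>x::real. \<Sum>i\<le>degree P. coeff P i * (x ^ Suc i / exp x)) = (\<lambda>x. x * (poly P x * exp (- x)))"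
        by (auto simp: poly_altdef sum_distrib_left sum_distrib_right exp_minus field_simps)
      ultimately show ?thesis by simp
    qed
    ultimately have "((\<lambda>x. a * exp (-x) + x * (poly P x * exp (- x))) \<longlongrightarrow> 0) at_top"
      using tendsto_add by fastforce
    then show ?case by (simp add: algebra_simps)
  qed simp
  from filterlim_compose[OF this, of "\<lambda>x. 1 / x" "at_right 0" P]
  show ?thesis
    by (simp add: filterlim_inverse_at_top_right inverse_eq_divide[symmetric])
qed

lemma smooth1_exp_step: "smooth1 exp_step"
proof -
  \<comment> \<open>This family is closed under differentiation. With \<open>y = 1 / x\<close>, the
    derivative of \<open>P(y) exp(-y)\<close> is \<open>y^2 (P(y) - P'(y)) exp(-y)\<close>, and
    \<open>[:0,0,1:]\<close> is the polynomial \<open>y^2\<close>. All derivatives are thus handled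
    by one induction over arbitrary \<open>P\<close>.\<close>
  define F where "F P x = (if x > 0 then poly P (1 / x) * exp (- 1 / x) else (0::real))" for P x
  have deriv: "(F P has_real_derivative F ([:0,0,1:] * (P - pderiv P)) x) (at x)" for P x
  proof (cases x "0::real" rule: linorder_cases)
    case less
    have "((\<lambda>x. 0::real) has_real_derivative 0) (at x)" by simp
    then have "(F P has_real_derivative 0) (at x)"
      by (rule has_field_derivative_transform_within_open[of _ _ _ "{..<0}"]) (use less in \<open>auto simp: F_def\<close>)
    then show ?thesis using less by (simp add: F_def)
  next
    case greater
    have "((\<lambda>x. poly P (1 / x) * exp (- 1 / x)) has_real_derivative
        F ([:0,0,1:] * (P - pderiv P)) x) (at x)"
      using greater
      by (auto intro!: derivative_eq_intros DERIV_chain2[OF poly_DERIV] simp: F_def power2_eq_square field_simps)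
    then show ?thesis
      by (rule has_field_derivative_transform_within_open[of _ _ _ "{0<..}"]) (use greater in \<open>auto simp: F_def\<close>)
  next
    case equal
    have "((\<lambda>y. (F P y - F P 0) / (y - 0)) \<longlongrightarrow> 0) (at 0)"
    proof (rule filterlim_split_at)
      show "((\<lambda>y. (F P y - F P 0) / (y - 0)) \<longlongrightarrow> 0) (at_left 0)"
        by (rule tendsto_eventually) (auto simp: F_def eventually_at_left_field intro!: exI[of _ "-1"])
      show "((\<lambda>y. (F P y - F P 0) / (y - 0)) \<longlongrightarrow> 0) (at_right 0)"
        \<comment> \<open>Dividing by \<open>y\<close> multiplies the polynomial in
          \<open>1 / y\<close> by its variable, which is the factor \<open>[:0,1:]\<close>.\<close>
        using poly_exp_tendsto_0[of "[:0,1:] * P"]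
        by (rule Lim_transform_eventually)
           (auto simp: F_def eventually_at_right_field intro!: exI[of _ "1"])
    qed
    then show ?thesis using equal by (simp add: has_field_derivative_iff F_def)
  qed
  have "cd n (F P)" for n P
  proof (induction n arbitrary: P)
    case 0
    show ?case using deriv[of P] by (auto intro!: DERIV_continuous_on simp: has_field_derivative_at_within)
  next
    case (Suc n)
    show ?case by (rule cd_SucI[OF deriv Suc])
  qed
  moreover have "exp_step = F 1" by (auto simp: exp_step_def F_def)
  ultimately show ?thesis unfolding smooth1_def by metis
qed

text \<open>The parameter \<open>n\<close> sharpens the flanks and leaves the support in place:
  since \<open>exp_step\<close> tends to 1 at infinity, the bumps tend to the indicator of the open
  interval, with values in \<open>[0, 1]\<close> and without ever leaving it.\<close>

definition bump :: "real \<Rightarrow> real \<Rightarrow> nat \<Rightarrow> real \<Rightarrow> real" where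
  "bump A B n x = exp_step (real n * (x - A)) * exp_step (real n * (B - x))"

lemma smooth1_bump: "smooth1 (bump A B n)"
  using smooth1_mult[OF smooth1_affine[OF smooth1_exp_step, of n "- n * A"]
      smooth1_affine[OF smooth1_exp_step, of "- n" "n * B"]]
  by (simp add: bump_def[abs_def] algebra_simps)

lemma bump_nonneg: "0 \<le> bump A B n x" and bump_le_1: "bump A B n x \<le> 1"
proof -
  have *: "0 \<le> exp_step y" "exp_step y \<le> 1" for y by (auto simp: exp_step_def)
  show "0 \<le> bump A B n x" "bump A B n x \<le> 1" 
    unfolding bump_def using * by (auto intro: mult_le_one)
qed

lemma bump_eq_0: "x \<notin> {A<..<B} \<Longrightarrow> bump A B n x = 0"
  by (auto simp: bump_def exp_step_def mult_less_0_iff zero_less_mult_iff)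

lemma bump_pos: "A < x \<Longrightarrow> x < B \<Longrightarrow> n > 0 \<Longrightarrow> bump A B n x > 0"
  by (auto simp: bump_def exp_step_def)

lemma bump_tendsto: "(\<lambda>n. bump A B n x) \<longlonglongrightarrow> indicator {A<..<B} x"
proof (cases "x \<in> {A<..<B}")
  case True
  have *: "(\<lambda>n. exp_step (real n * c)) \<longlonglongrightarrow> 1" if "c > 0" for c
  proof -
    have "(\<lambda>n. exp (- (1 / c) * inverse (real (Suc n)))) \<longlonglongrightarrow> exp (- (1 / c) * 0)"
      by (intro tendsto_exp tendsto_mult tendsto_const LIMSEQ_inverse_real_of_nat)
    moreover have "(\<lambda>n. exp (- (1 / c) * inverse (real (Suc n)))) = (\<lambda>n. exp_step (real (Suc n) * c))"
      using that by (auto simp: exp_step_def divide_simps mult_pos_pos)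
    ultimately have "(\<lambda>n. exp_step (real (Suc n) * c)) \<longlonglongrightarrow> 1" by simp
    then show ?thesis using filterlim_sequentially_Suc by blast
  qed
  have "(\<lambda>n. bump A B n x) \<longlonglongrightarrow> 1 * 1"
    unfolding bump_def by (intro tendsto_mult *) (use True in auto)
  then show ?thesis using True by simp
next
  case False
  then show ?thesis by (simp add: bump_eq_0)
qed

subsection \<open>Test functions on the plane\<close>

lemma pd_eq: "(f has_derivative f') (at x) \<Longrightarrow> pd i f x = f' (axis i 1)"
  unfolding pd_def using frechet_derivative_at by force

lemma differentiable_has_pd:
  "f differentiable (at x) \<Longrightarrow> (f has_derivative frechet_derivative f (at x)) (at x)"
  using frechet_derivative_works by blast

lemma Ck_differentiable: "Ck (Suc n) f \<Longrightarrow> f differentiable (at x)"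
  by (simp add: differentiable_on_def)

lemma Ck_Suc_imp: "Ck (Suc n) f \<Longrightarrow> Ck n f"
proof (induction n arbitrary: f)
  case (Suc n)
  then show ?case by (metis Ck.simps(2))
qed auto

lemma Ck_SucI:
  assumes "\<And>x. f differentiable (at x)" "\<And>i. Ck n (pd i f)"
  shows "Ck (Suc n) f"
  using assms by (auto simp: differentiable_on_def intro!: differentiable_imp_continuous_on)

lemma Ck_const: "Ck n (\<lambda>x. c)"
proof (induction n arbitrary: c)
  case (Suc n)
  have "pd i (\<lambda>x. c) = (\<lambda>x. 0)" for i by (simp add: pd_def)
  then show ?case using Suc by (auto intro!: Ck_SucI)
qed auto

lemma pd_add:
  assumes "f differentiable (at x)" "g differentiable (at x)"
  shows "pd i (\<lambda>x. f x + g x) x = pd i f x + pd i g x"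
  using pd_eq[OF has_derivative_add[OF assms[THEN differentiable_has_pd]]]
  by (simp add: pd_def)

lemma pd_mult:
  assumes "f differentiable (at x)" "g differentiable (at x)"
  shows "pd i (\<lambda>x. f x * g x) x = f x * pd i g x + pd i f x * g x"
  using pd_eq[OF has_derivative_mult[OF assms[THEN differentiable_has_pd]]]
  by (simp add: pd_def)

lemma pd_cmult: "f differentiable (at x) \<Longrightarrow> pd i (\<lambda>x. c * f x) x = c * pd i f x"
  using pd_mult[of "\<lambda>_. c" x f i] by (simp add: pd_def)

lemma Ck_add: "Ck n f \<Longrightarrow> Ck n g \<Longrightarrow> Ck n (\<lambda>x. f x + g x)"
proof (induction n arbitrary: f g)
  case (Suc n)
  note d = Ck_differentiable[OF Suc.prems(1)] Ck_differentiable[OF Suc.prems(2)]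
  have "pd i (\<lambda>x. f x + g x) = (\<lambda>x. pd i f x + pd i g x)" for i
    using d by (auto simp: pd_add)
  then show ?case using Suc d by (intro Ck_SucI) (auto intro: differentiable_add)
qed (auto intro: continuous_intros)

lemma Ck_mult: "Ck n f \<Longrightarrow> Ck n g \<Longrightarrow> Ck n (\<lambda>x. f x * g x)"
proof (induction n arbitrary: f g)
  case (Suc n)
  note d = Ck_differentiable[OF Suc.prems(1)] Ck_differentiable[OF Suc.prems(2)]
  have "pd i (\<lambda>x. f x * g x) = (\<lambda>x. f x * pd i g x + pd i f x * g x)" for i
    using d by (auto simp: pd_mult)
  then show ?case using Suc d Ck_Suc_imp[of n f] Ck_Suc_imp[of n g]
    by (intro Ck_SucI) (auto intro!: Ck_add differentiable_mult)
qed (auto intro: continuous_intros)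

text \<open>A partial derivative of a function of \<open>a \<bullet> y\<close> is again such a
  function, up to a constant factor. This makes \<open>Ck\<close> for these functions an induction
  over smooth functions on the line.\<close>

lemma has_derivative_ridge:
  assumes "(\<alpha> has_real_derivative \<alpha>') (at (a \<bullet> y))"
  shows "((\<lambda>y. \<alpha> (a \<bullet> y)) has_derivative (\<lambda>h. (a \<bullet> h) * \<alpha>')) (at y)"
proof -
  have "((\<lambda>y. \<alpha> (a \<bullet> y)) has_derivative ((*) \<alpha>' \<circ> (\<lambda>h. a \<bullet> h))) (at y)"
    using diff_chain_at[of "\<lambda>y. a \<bullet> y" "\<lambda>h. a \<bullet> h" y \<alpha> "(*) \<alpha>'",
        OF bounded_linear_imp_has_derivative[OF bounded_linear_inner_right]] assms
    by (simp add: has_field_derivative_def o_def)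
  then show ?thesis by (simp add: o_def mult.commute)
qed

lemma pd_ridge:
  assumes "smooth1 \<alpha>"
  shows "pd i (\<lambda>y. \<alpha> (a \<bullet> y)) = (\<lambda>y. deriv \<alpha> (a \<bullet> y) * (a $ i))"
proof
  fix y show "pd i (\<lambda>y. \<alpha> (a \<bullet> y)) y = deriv \<alpha> (a \<bullet> y) * (a $ i)"
    using pd_eq[OF has_derivative_ridge[OF smooth1_has_deriv[OF assms]]]
    by (simp add: inner_axis)
qed

lemma ridge_differentiable: "smooth1 \<alpha> \<Longrightarrow> (\<lambda>y. \<alpha> (a \<bullet> y)) differentiable (at y)"
  using has_derivative_ridge[OF smooth1_has_deriv] differentiable_def by blast

lemma Ck_ridge: "smooth1 \<alpha> \<Longrightarrow> Ck n (\<lambda>y. \<alpha> (a \<bullet> y))"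
proof (induction n arbitrary: \<alpha>)
  case 0
  then show ?case
    by (auto intro!: continuous_on_compose2[OF smooth1_continuous[of \<alpha> UNIV]] continuous_intros)
next
  case (Suc n)
  then show ?case
    by (intro Ck_SucI) (auto simp: pd_ridge intro!: ridge_differentiable Ck_mult Ck_const smooth1_deriv)
qed

lemma smooth_differentiable: "smooth f \<Longrightarrow> f differentiable (at x)"
  using Ck_differentiable smooth_def by blast

lemma smooth_continuous: "smooth f \<Longrightarrow> continuous_on S f"
  using continuous_on_subset[of UNIV f S] by (auto simp: smooth_def dest: spec[of _ 0])

lemma smooth_pd: "smooth f \<Longrightarrow> smooth (pd i f)"
  by (metis Ck.simps(2) smooth_def)

lemma smooth_add: "smooth f \<Longrightarrow> smooth g \<Longrightarrow> smooth (\<lambda>x. f x + g x)"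
  by (simp add: smooth_def Ck_add)

lemma smooth_cmult: "smooth f \<Longrightarrow> smooth (\<lambda>x. c * f x)"
  by (simp add: smooth_def Ck_mult Ck_const)

lemma test_funI:
  assumes "smooth \<phi>" "compact K" "K \<subseteq> \<Omega>" "\<And>x. x \<notin> K \<Longrightarrow> \<phi> x = 0"
  shows "test_fun \<Omega> \<phi>"
proof -
  have "closure {x. \<phi> x \<noteq> 0} \<subseteq> K"
    using assms by (intro closure_minimal) (auto intro: compact_imp_closed)
  moreover have "compact (closure {x. \<phi> x \<noteq> 0})"
    using bounded_subset[OF compact_imp_bounded[OF assms(2)], of "{x. \<phi> x \<noteq> 0}"] assms(4)
    by (subst compact_closure) blast
  ultimately show ?thesis
    using assms unfolding test_fun_def by blast
qed

lemma test_funE: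
  assumes "test_fun \<Omega> \<phi>"
  obtains K where "smooth \<phi>" "compact K" "K \<subseteq> \<Omega>" "\<And>x. x \<notin> K \<Longrightarrow> \<phi> x = 0"
  using assms closure_subset[of "{x. \<phi> x \<noteq> 0}"] unfolding test_fun_def by blast

lemma test_fun_add:
  assumes "test_fun \<Omega> \<phi>" "test_fun \<Omega> \<psi>"
  shows "test_fun \<Omega> (\<lambda>x. \<phi> x + \<psi> x)"
proof -
  obtain K where K: "smooth \<phi>" "compact K" "K \<subseteq> \<Omega>" "\<And>x. x \<notin> K \<Longrightarrow> \<phi> x = 0"
    using assms(1) by (rule test_funE) blast
  obtain L where L: "smooth \<psi>" "compact L" "L \<subseteq> \<Omega>" "\<And>x. x \<notin> L \<Longrightarrow> \<psi> x = 0"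
    using assms(2) by (rule test_funE) blast
  show ?thesis
    by (rule test_funI[of _ "K \<union> L"]) (use K L in \<open>auto intro: smooth_add\<close>)
qed

lemma test_fun_cmult: "test_fun \<Omega> \<phi> \<Longrightarrow> test_fun \<Omega> (\<lambda>x. c * \<phi> x)"
  by (elim test_funE, rule test_funI) (auto intro: smooth_cmult)

lemma pd_eq_0:
  assumes "closed K" "\<And>x. x \<notin> K \<Longrightarrow> \<phi> x = 0" "x \<notin> K"
  shows "pd i \<phi> x = 0"
proof -
  have "(\<phi> has_derivative (\<lambda>h. 0)) (at x)"
    by (rule has_derivative_transform_within_open[of "\<lambda>x. 0" _ _ _ "- K"]) (use assms in auto)
  then show ?thesis using pd_eq by fastforce
qed

lemma test_fun_pd:
  assumes "test_fun \<Omega> \<phi>"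
  shows "test_fun \<Omega> (pd i \<phi>)"
proof -
  obtain K where K: "smooth \<phi>" "compact K" "K \<subseteq> \<Omega>" "\<And>x. x \<notin> K \<Longrightarrow> \<phi> x = 0"
    using assms by (rule test_funE) blast
  show ?thesis
  proof (rule test_funI[OF smooth_pd[OF K(1)] K(2,3)])
    show "pd i \<phi> x = 0" if "x \<notin> K" for x
      using compact_imp_closed[OF K(2)] K(4) that by (rule pd_eq_0)
  qed
qed

lemma test_fun_bounded:
  assumes "test_fun \<Omega> \<phi>"
  obtains M where "M > 0" "\<And>x. \<bar>\<phi> x\<bar> \<le> M"
proof -
  obtain K where K: "smooth \<phi>" "compact K" "K \<subseteq> \<Omega>" "\<And>x. x \<notin> K \<Longrightarrow> \<phi> x = 0"
    using assms by (rule test_funE) blast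
  have "bounded (\<phi> ` K)"
    using K by (intro compact_imp_bounded compact_continuous_image smooth_continuous)
  then obtain M where "M > 0" "\<forall>x\<in>\<phi> ` K. norm x \<le> M" using bounded_pos by blast
  then show ?thesis using that[of M] K by (metis abs_0 imageI less_eq_real_def real_norm_def)
qed

section \<open>Parallelogram coordinates and product test functions\<close>

locale dual_frame =
  fixes a b d e :: "real^2"
  assumes ad: "a \<bullet> d = 1" and ae: "a \<bullet> e = 0" and bd: "b \<bullet> d = 0" and be: "b \<bullet> e = 1"
    and expand: "y = (a \<bullet> y) *\<^sub>R d + (b \<bullet> y) *\<^sub>R e"
begin

definition pgram :: "real \<Rightarrow> real \<Rightarrow> real \<Rightarrow> real \<Rightarrow> (real^2) set" where
  "pgram A B A' B' = {y. a \<bullet> y \<in> {A..B} \<and> b \<bullet> y \<in> {A'..B'}}"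

lemma compact_pgram: "compact (pgram A B A' B')"
proof -
  have "pgram A B A' B' = (\<lambda>(s,t). s *\<^sub>R d + t *\<^sub>R e) ` ({A..B} \<times> {A'..B'})"
  proof (intro equalityI subsetI)
    fix y assume "y \<in> pgram A B A' B'"
    then show "y \<in> (\<lambda>(s,t). s *\<^sub>R d + t *\<^sub>R e) ` ({A..B} \<times> {A'..B'})"
      using expand[of y] by (intro image_eqI[of _ _ "(a \<bullet> y, b \<bullet> y)"]) (auto simp: pgram_def)
  qed (auto simp: pgram_def inner_add_right ad ae bd be)
  also have "compact \<dots>"
    by (intro compact_continuous_image compact_Times)
       (auto simp: case_prod_beta intro!: continuous_intros)
  finally show ?thesis .
qed

text \<open>Shows how short the sides must be for a parallelogram to stay in a given ball around its
  corner.\<close>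

lemma pgram_norm_le:
  assumes "x \<in> pgram (a \<bullet> y) (a \<bullet> y + h) (b \<bullet> y) (b \<bullet> y + h)"
  shows "norm (x - y) \<le> h * (norm d + norm e)"
proof -
  have "x - y = (a \<bullet> (x - y)) *\<^sub>R d + (b \<bullet> (x - y)) *\<^sub>R e" by (rule expand)
  then have "norm (x - y) \<le> \<bar>a \<bullet> (x - y)\<bar> * norm d + \<bar>b \<bullet> (x - y)\<bar> * norm e"
    by (metis norm_scaleR norm_triangle_ineq)
  also have "\<dots> \<le> h * norm d + h * norm e"
    using assms by (intro add_mono mult_right_mono) (auto simp: pgram_def inner_diff_right)
  finally show ?thesis by (simp add: distrib_left)
qed

definition tensor :: "(real \<Rightarrow> real) \<Rightarrow> (real \<Rightarrow> real) \<Rightarrow> pfun" where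
  "tensor \<alpha> \<beta> y = \<alpha> (a \<bullet> y) * \<beta> (b \<bullet> y)"

lemma test_fun_tensor:
  assumes "smooth1 \<alpha>" "smooth1 \<beta>" "pgram A B A' B' \<subseteq> \<Omega>"
    and "\<And>s. s \<notin> {A..B} \<Longrightarrow> \<alpha> s = 0" "\<And>s. s \<notin> {A'..B'} \<Longrightarrow> \<beta> s = 0"
  shows "test_fun \<Omega> (tensor \<alpha> \<beta>)"
proof (rule test_funI[OF _ compact_pgram assms(3)])
  show "smooth (tensor \<alpha> \<beta>)"
    using assms unfolding tensor_def[abs_def] smooth_def by (auto intro!: Ck_mult Ck_ridge)
  show "tensor \<alpha> \<beta> x = 0" if "x \<notin> pgram A B A' B'" for x
    using that assms(4,5) by (auto simp: tensor_def pgram_def simp del: atLeastAtMost_iff)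
qed

lemma pd_tensor:
  assumes "smooth1 \<alpha>" "smooth1 \<beta>"
  shows "pd i (tensor \<alpha> \<beta>) = (\<lambda>y. a $ i * tensor (deriv \<alpha>) \<beta> y + b $ i * tensor \<alpha> (deriv \<beta>) y)"
proof
  fix y
  have "pd i (tensor \<alpha> \<beta>) y = pd i (\<lambda>y. \<alpha> (a \<bullet> y) * \<beta> (b \<bullet> y)) y"
    by (simp add: tensor_def[abs_def])
  also have "\<dots> = \<alpha> (a \<bullet> y) * (deriv \<beta> (b \<bullet> y) * b $ i) + deriv \<alpha> (a \<bullet> y) * a $ i * \<beta> (b \<bullet> y)"
    using assms by (simp add: pd_mult ridge_differentiable pd_ridge)
  finally show "pd i (tensor \<alpha> \<beta>) y = a $ i * tensor (deriv \<alpha>) \<beta> y + b $ i * tensor \<alpha> (deriv \<beta>) y"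
    by (simp add: tensor_def algebra_simps)
qed

lemma smooth_tensor: "smooth1 \<alpha> \<Longrightarrow> smooth1 \<beta> \<Longrightarrow> smooth (tensor \<alpha> \<beta>)"
  unfolding tensor_def[abs_def] smooth_def by (auto intro!: Ck_mult Ck_ridge)

lemma sum_ad: "(\<Sum>i\<in>UNIV. d $ i * a $ i) = 1" and sum_ae: "(\<Sum>i\<in>UNIV. e $ i * a $ i) = 0"
  and sum_bd: "(\<Sum>i\<in>UNIV. d $ i * b $ i) = 0" and sum_be: "(\<Sum>i\<in>UNIV. e $ i * b $ i) = 1"
  using ad ae bd be by (simp_all add: inner_vec_def mult.commute)

text \<open>Since \<open>a \<bullet> d = 1\<close> and \<open>b \<bullet> d = 0\<close>,
  differentiating along \<open>d\<close> moves only the first coordinate and hits only the first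
  factor. The two lemmas that follow rest on the same duality.\<close>

lemma sum_d_pd_tensor:
  assumes "smooth1 \<alpha>" "smooth1 \<beta>"
  shows "(\<Sum>i\<in>UNIV. d $ i * pd i (tensor \<alpha> \<beta>) y) = tensor (deriv \<alpha>) \<beta> y"
proof -
  have "(\<Sum>i\<in>UNIV. d $ i * pd i (tensor \<alpha> \<beta>) y) =
    (\<Sum>i\<in>UNIV. d $ i * a $ i) * tensor (deriv \<alpha>) \<beta> y + (\<Sum>i\<in>UNIV. d $ i * b $ i) * tensor \<alpha> (deriv \<beta>) y"
    by (simp add: pd_tensor[OF assms] sum_2 algebra_simps)
  then show ?thesis by (simp add: sum_ad sum_bd)
qed

lemma sum_e_pd_tensor:
  assumes "smooth1 \<alpha>" "smooth1 \<beta>"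
  shows "(\<Sum>i\<in>UNIV. e $ i * pd i (tensor \<alpha> \<beta>) y) = tensor \<alpha> (deriv \<beta>) y"
proof -
  have "(\<Sum>i\<in>UNIV. e $ i * pd i (tensor \<alpha> \<beta>) y) =
    (\<Sum>i\<in>UNIV. e $ i * a $ i) * tensor (deriv \<alpha>) \<beta> y + (\<Sum>i\<in>UNIV. e $ i * b $ i) * tensor \<alpha> (deriv \<beta>) y"
    by (simp add: pd_tensor[OF assms] sum_2 algebra_simps)
  then show ?thesis by (simp add: sum_ae sum_be)
qed

lemma sum_de_pd_tensor:
  assumes "smooth1 \<alpha>" "smooth1 \<beta>"
  shows "(\<Sum>i\<in>UNIV. \<Sum>j\<in>UNIV. d $ i * e $ j * pd i (pd j (tensor \<alpha> \<beta>)) y) = tensor (deriv \<alpha>) (deriv \<beta>) y"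
proof -
  have sm: "smooth1 (deriv \<alpha>)" "smooth1 (deriv \<beta>)" using assms by (auto intro: smooth1_deriv)
  have pdd: "pd i (pd j (tensor \<alpha> \<beta>)) y =
      a $ j * pd i (tensor (deriv \<alpha>) \<beta>) y + b $ j * pd i (tensor \<alpha> (deriv \<beta>)) y" for i j
  proof -
    have "pd i (pd j (tensor \<alpha> \<beta>)) y =
       pd i (\<lambda>y. a $ j * tensor (deriv \<alpha>) \<beta> y + b $ j * tensor \<alpha> (deriv \<beta>) y) y"
      by (simp add: pd_tensor[OF assms])
    also have "\<dots> = pd i (\<lambda>y. a $ j * tensor (deriv \<alpha>) \<beta> y) y + pd i (\<lambda>y. b $ j * tensor \<alpha> (deriv \<beta>) y) y"
      using assms sm by (intro pd_add smooth_differentiable smooth_cmult smooth_tensor)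
    also have "pd i (\<lambda>y. a $ j * tensor (deriv \<alpha>) \<beta> y) y = a $ j * pd i (tensor (deriv \<alpha>) \<beta>) y"
      using assms sm by (intro pd_cmult smooth_differentiable smooth_tensor)
    also have "pd i (\<lambda>y. b $ j * tensor \<alpha> (deriv \<beta>) y) y = b $ j * pd i (tensor \<alpha> (deriv \<beta>)) y"
      using assms sm by (intro pd_cmult smooth_differentiable smooth_tensor)
    finally show ?thesis .
  qed
  have "(\<Sum>i\<in>UNIV. \<Sum>j\<in>UNIV. d $ i * e $ j * pd i (pd j (tensor \<alpha> \<beta>)) y)
    = (\<Sum>j\<in>UNIV. e $ j * a $ j) * (\<Sum>i\<in>UNIV. d $ i * pd i (tensor (deriv \<alpha>) \<beta>) y)
     + (\<Sum>j\<in>UNIV. e $ j * b $ j) * (\<Sum>i\<in>UNIV. d $ i * pd i (tensor \<alpha> (deriv \<beta>)) y)"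
    by (simp add: pdd sum_2 algebra_simps)
  then show ?thesis using assms sm by (simp add: sum_ae sum_be sum_d_pd_tensor)
qed

end

lemma standard_dual_frame: "dual_frame (axis 1 1) (axis 2 1) (axis 1 1) (axis 2 (1::real))"
proof
  fix y :: "real^2"
  show "y = (axis 1 1 \<bullet> y) *\<^sub>R axis 1 1 + (axis 2 1 \<bullet> y) *\<^sub>R axis 2 1"
    by (auto simp: vec_eq_iff forall_2 inner_axis' axis_def[of _ 1, symmetric]) (auto simp: axis_def)
qed (simp_all add: inner_vec_def sum_2 axis_def)

section \<open>Change to frame coordinates and Lebesgue differentiation\<close>

context dual_frame begin

definition chart :: "real^2 \<Rightarrow> real^2" where
  "chart z = (z $ 1) *\<^sub>R d + (z $ 2) *\<^sub>R e"

lemma linear_chart: "linear chart"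
  by (rule linearI) (simp_all add: chart_def algebra_simps)

lemma a_chart: "a \<bullet> chart z = z $ 1" and b_chart: "b \<bullet> chart z = z $ 2"
  by (simp_all add: chart_def inner_add_right ad ae bd be)

lemma inj_chart: "inj chart"
proof (rule injI)
  fix x y assume "chart x = chart y"
  then have "x $ 1 = y $ 1" "x $ 2 = y $ 2"
    by (metis a_chart, metis b_chart)
  then show "x = y" by (simp add: vec_eq_iff forall_2)
qed

lemma surj_chart: "chart (\<chi> i. if i = 1 then a \<bullet> y else b \<bullet> y) = y"
  using expand[of y] by (simp add: chart_def)

text \<open>The area of the parallelogram spanned by \<open>d\<close> and \<open>e\<close>.\<close>

definition jac :: real where "jac = \<bar>det (matrix chart)\<bar>"

lemma jac_pos: "jac > 0"
  using det_nz_iff_inj[OF linear_chart] inj_chart by (simp add: jac_def)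

lemma chart_image_cbox:
  "chart ` cbox z (z + t *\<^sub>R One) = pgram (z $ 1) (z $ 1 + t) (z $ 2) (z $ 2 + t)"
proof -
  have One: "(One :: real^2) $ i = 1" for i
    using inner_sum_left_Basis[of "axis i (1::real)" "\<lambda>_. 1"] by (simp add: inner_axis)
  have cbox: "w \<in> cbox z (z + t *\<^sub>R One) \<longleftrightarrow>
      w $ 1 \<in> {z $ 1..z $ 1 + t} \<and> w $ 2 \<in> {z $ 2..z $ 2 + t}" for w
    by (simp only: mem_box_cart forall_2 vector_add_component vector_scaleR_component One) auto
  show ?thesis
  proof (intro equalityI subsetI)
    fix y assume "y \<in> pgram (z $ 1) (z $ 1 + t) (z $ 2) (z $ 2 + t)"
    then show "y \<in> chart ` cbox z (z + t *\<^sub>R One)"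
      by (intro image_eqI[of _ _ "\<chi> i. if i = 1 then a \<bullet> y else b \<bullet> y"])
         (simp_all add: cbox pgram_def surj_chart)
  qed (auto simp: cbox pgram_def a_chart b_chart)
qed

lemma absolutely_integrable_chart:
  fixes f :: "real^2 \<Rightarrow> real"
  assumes "f absolutely_integrable_on UNIV"
  shows "(f \<circ> chart) absolutely_integrable_on UNIV"
proof -
  \<comment> \<open>The linear change of variables is applied to vector-valued maps, so the values
    are placed in \<open>real^1\<close>; the component along the single axis gives back
    \<open>f\<close>.\<close>
  define F :: "real^2 \<Rightarrow> real^1" where "F x = (\<chi> i. f x)" for x
  have eq: "(\<lambda>x. F x \<bullet> i) = f" "(\<lambda>x. (F \<circ> chart) x \<bullet> i) = f \<circ> chart" if "i \<in> Basis" for i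
    using that by (auto simp: F_def axis_eq_axis Basis_vec_def inner_axis)
  have "F absolutely_integrable_on chart ` UNIV"
    using assms eq(1) surjI[of chart, OF surj_chart] by (simp add: absolutely_integrable_componentwise_iff[where f=F])
  then have "(F \<circ> chart) absolutely_integrable_on UNIV"
    using absolutely_integrable_on_linear_image[OF linear_chart] jac_pos by (auto simp: jac_def)
  moreover have B: "axis 1 1 \<in> (Basis :: (real^1) set)" by simp
  ultimately show ?thesis
    using eq(2)[OF B] absolutely_integrable_componentwise_iff[where f="F \<circ> chart" and A=UNIV]
    by metis
qed

lemma integral_chart:
  fixes f :: "real^2 \<Rightarrow> real"
  assumes f: "f absolutely_integrable_on UNIV" and "S \<in> sets lebesgue" "chart ` S \<in> sets lebesgue"
  shows "integral (chart ` S) f = jac * integral S (f \<circ> chart)"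
proof -
  define F :: "real^2 \<Rightarrow> real^1" where "F x = (\<chi> i. f x)" for x
  have eq: "(\<lambda>x. F x \<bullet> i) = f" "(\<lambda>x. (F \<circ> chart) x \<bullet> i) = f \<circ> chart" if "i \<in> Basis" for i
    using that by (auto simp: F_def axis_eq_axis Basis_vec_def inner_axis)
  have f1: "f absolutely_integrable_on chart ` S"
    using f assms(3) by (rule set_integrable_subset) simp
  have f2: "(f \<circ> chart) absolutely_integrable_on S"
    using absolutely_integrable_chart[OF f] assms(2) by (rule set_integrable_subset) simp
  have F1: "F absolutely_integrable_on chart ` S"
    using f1 eq(1) by (simp add: absolutely_integrable_componentwise_iff[where f=F])
  have F2: "(F \<circ> chart) absolutely_integrable_on S"
    using f2 eq(2) absolutely_integrable_componentwise_iff[where f="F \<circ> chart" and A=S] by metis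
  have B: "axis 1 1 \<in> (Basis :: (real^1) set)" by simp
  have "integral (chart ` S) F = jac *\<^sub>R integral S (F \<circ> chart)"
    unfolding jac_def using F1 linear_chart by (intro integral_change_of_variables_linear) auto
  then have "integral (chart ` S) F \<bullet> axis 1 1 = jac * (integral S (F \<circ> chart) \<bullet> axis 1 1)"
    by simp
  then show ?thesis
    using F1 F2 eq[OF B] integral_component_eq[of F "chart ` S" "axis 1 1"]
      integral_component_eq[of "F \<circ> chart" S "axis 1 1"]
    by (simp add: set_lebesgue_integral_eq_integral(1) o_def)
qed

text \<open>In frame coordinates the parallelograms become squares with \<open>x\<close> as a
  corner, and at almost every point averages over such squares converge to the value. The area is
  \<open>jac * t^2\<close>, whence the quotient \<open>M / jac\<close>. Corners instead of centres
  matter because near the boundary only one-sided neighbourhoods fit into the domain.\<close>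

lemma lebesgue_differentiation_bound:
  fixes f :: "real^2 \<Rightarrow> real"
  assumes f: "f absolutely_integrable_on UNIV"
    and bound: "\<And>y. y \<in> U \<Longrightarrow> \<exists>\<delta>>0. \<forall>t. 0 < t \<and> t < \<delta> \<longrightarrow>
        \<bar>integral (pgram (a \<bullet> y) (a \<bullet> y + t) (b \<bullet> y) (b \<bullet> y + t)) f\<bar> \<le> M * t^2"
  obtains N where "negligible N" "\<And>x. x \<in> U \<Longrightarrow> x \<notin> N \<Longrightarrow> \<bar>f x\<bar> \<le> M / jac"
proof -
  let ?F = "f \<circ> chart"
  have F: "?F absolutely_integrable_on UNIV"
    using f by (rule absolutely_integrable_chart)
  have "?F integrable_on cbox x y" for x y
    using F by (meson integrable_on_subcbox set_lebesgue_integral_eq_integral(1) subset_UNIV)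
  then obtain N where N: "negligible N" and lim: "\<And>x \<epsilon>. \<lbrakk>x \<notin> N; 0 < \<epsilon>\<rbrakk> \<Longrightarrow> \<exists>\<delta>>0. \<forall>h. 0 < h \<and> h < \<delta> \<longrightarrow>
      norm (integral (cbox x (x + h *\<^sub>R One)) ?F /\<^sub>R h ^ DIM(real^2) - ?F x) < \<epsilon>"
    by (rule integrable_ccontinuous_explicit) blast
  \<comment> \<open>The exceptional set lives in coordinate space and has to be carried back to the
    plane, where it stays null because \<open>chart\<close> is linear.\<close>
  have "negligible (chart ` N)"
    using N linear_chart by (intro negligible_differentiable_image_negligible)
      (auto intro: linear_imp_differentiable_on)
  moreover have "\<bar>f x\<bar> \<le> M / jac" if x: "x \<in> U" "x \<notin> chart ` N" for x
  proof (rule field_le_epsilon)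
    fix \<epsilon> :: real assume "\<epsilon> > 0"
    define z :: "real^2" where "z = (\<chi> i. if i = 1 then a \<bullet> x else b \<bullet> x)"
    have z: "chart z = x" by (simp add: z_def surj_chart)
    then have "z \<notin> N" using x by auto
    obtain \<delta> where \<delta>: "\<delta> > 0" "\<And>t. 0 < t \<and> t < \<delta> \<longrightarrow>
        \<bar>integral (pgram (a \<bullet> x) (a \<bullet> x + t) (b \<bullet> x) (b \<bullet> x + t)) f\<bar> \<le> M * t^2"
      using bound[OF x(1)] by blast
    obtain \<delta>' where \<delta>': "\<delta>' > 0" "\<And>h. 0 < h \<and> h < \<delta>' \<longrightarrow>
      norm (integral (cbox z (z + h *\<^sub>R One)) ?F /\<^sub>R h ^ DIM(real^2) - ?F z) < \<epsilon>"
      using lim[OF \<open>z \<notin> N\<close> \<open>\<epsilon> > 0\<close>] by blast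
    define t where "t = min \<delta> \<delta>' / 2"
    have t: "0 < t" "t < \<delta>" "t < \<delta>'" using \<delta>(1) \<delta>'(1) by (auto simp: t_def)
    let ?I = "integral (cbox z (z + t *\<^sub>R One)) ?F"
    have "integral (chart ` cbox z (z + t *\<^sub>R One)) f = jac * ?I"
      using f
      by (intro integral_chart)
         (auto simp: chart_image_cbox intro!: lmeasurable_compact[OF compact_pgram, THEN fmeasurableD])
    also have "integral (chart ` cbox z (z + t *\<^sub>R One)) f =
        integral (pgram (a \<bullet> x) (a \<bullet> x + t) (b \<bullet> x) (b \<bullet> x + t)) f"
      by (simp add: chart_image_cbox flip: z a_chart b_chart)
    finally have "jac * \<bar>?I\<bar> \<le> M * t^2"
      using \<delta>(2)[of t] t(1,2) jac_pos abs_mult[of jac ?I] by (simp add: o_def)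
    then have "\<bar>?I\<bar> / t^2 \<le> M / jac"
      using t jac_pos by (simp add: field_simps)
    moreover have "\<bar>?I / t^2 - f x\<bar> < \<epsilon>"
      using \<delta>'(2)[of t] t z by (simp add: divide_inverse mult.commute)
    ultimately show "\<bar>f x\<bar> \<le> M / jac + \<epsilon>"
      using abs_divide[of ?I "t^2"] by (simp add: abs_if split: if_splits)
  qed
  ultimately show thesis using that by blast
qed

end

subsection \<open>Weak derivatives on a bounded open set\<close>

locale bounded_open =
  fixes \<Omega> :: "(real^2) set"
  assumes open_\<Omega>: "open \<Omega>" and bounded_\<Omega>: "bounded \<Omega>"
begin

abbreviation "\<mu> \<equiv> lebesgue_on \<Omega>"

lemma lmeasurable_\<Omega>: "\<Omega> \<in> lmeasurable"
  using bounded_\<Omega> open_\<Omega> by (rule lmeasurable_open)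

lemma sets_\<Omega>: "\<Omega> \<in> sets lebesgue"
  using lmeasurable_\<Omega> by blast

lemma finite_measure_\<mu>: "finite_measure \<mu>"
  using lmeasurable_\<Omega> by (rule finite_measure_lebesgue_on)

lemma integrable_const_\<mu>: "integrable \<mu> (\<lambda>x. c :: real)"
  using finite_measure_\<mu> by (rule finite_measure.integrable_const)

lemma L2_measurable: "L2 \<Omega> u \<Longrightarrow> u \<in> borel_measurable \<mu>"
  by (simp add: L2_def)

lemma L2_mult:
  assumes "L2 \<Omega> u" "L2 \<Omega> v"
  shows "integrable \<mu> (\<lambda>x. u x * v x)"
proof (rule Bochner_Integration.integrable_bound)
  show "integrable \<mu> (\<lambda>x. (u x)\<^sup>2 + (v x)\<^sup>2)"
    using assms by (auto simp: L2_def)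
  show "(\<lambda>x. u x * v x) \<in> borel_measurable \<mu>"
    using assms by (auto simp: L2_def)
  show "AE x in \<mu>. norm (u x * v x) \<le> norm ((u x)\<^sup>2 + (v x)\<^sup>2)"
  proof (rule AE_I2)
    fix x
    have "2 * (\<bar>u x\<bar> * \<bar>v x\<bar>) \<le> (u x)\<^sup>2 + (v x)\<^sup>2"
      using sum_squares_bound[of "\<bar>u x\<bar>" "\<bar>v x\<bar>"] by (simp add: mult.assoc)
    moreover have "0 \<le> \<bar>u x\<bar> * \<bar>v x\<bar>" by simp
    ultimately show "norm (u x * v x) \<le> norm ((u x)\<^sup>2 + (v x)\<^sup>2)"
      unfolding real_norm_def abs_mult by linarith
  qed
qed

lemma L2_lincomb:
  assumes "L2 \<Omega> u" "L2 \<Omega> v"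
  shows "L2 \<Omega> (\<lambda>x. u x + c * v x)"
proof -
  have "integrable \<mu> (\<lambda>x. (u x)\<^sup>2 + 2 * c * (u x * v x) + c^2 * (v x)\<^sup>2)"
    using assms L2_mult[OF assms] by (auto simp: L2_def)
  moreover have "(\<lambda>x. (u x)\<^sup>2 + 2 * c * (u x * v x) + c^2 * (v x)\<^sup>2) = (\<lambda>x. (u x + c * v x)\<^sup>2)"
    by (auto simp: power2_eq_square algebra_simps)
  ultimately show ?thesis using assms by (auto simp: L2_def)
qed

lemma L2_const: "L2 \<Omega> (\<lambda>x. c)"
  by (simp add: L2_def integrable_const_\<mu>)

lemma L2_integrable: "L2 \<Omega> u \<Longrightarrow> integrable \<mu> u"
  using L2_mult[OF _ L2_const[of 1]] by simp

lemma test_fun_measurable: "test_fun \<Omega> \<phi> \<Longrightarrow> \<phi> \<in> borel_measurable \<mu>"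
  by (intro continuous_imp_measurable_on_sets_lebesgue sets_\<Omega>) (auto simp: test_fun_def intro: smooth_continuous)

lemma integrable_mult_bounded:
  fixes u \<phi> :: pfun
  assumes u: "integrable \<mu> u" and \<phi>: "\<phi> \<in> borel_measurable \<mu>" and M: "\<And>x. \<bar>\<phi> x\<bar> \<le> M"
  shows "integrable \<mu> (\<lambda>x. u x * \<phi> x)"
    and "\<bar>integral\<^sup>L \<mu> (\<lambda>x. u x * \<phi> x)\<bar> \<le> M * integral\<^sup>L \<mu> (\<lambda>x. \<bar>u x\<bar>)"
proof -
  have M0: "M \<ge> 0" using M[of undefined] by linarith
  have int: "integrable \<mu> (\<lambda>x. M * \<bar>u x\<bar>)" using u by auto
  have le: "\<bar>u x * \<phi> x\<bar> \<le> M * \<bar>u x\<bar>" for x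
    using mult_right_mono[OF M, of "\<bar>u x\<bar>" x] by (simp add: abs_mult mult.commute)
  show i: "integrable \<mu> (\<lambda>x. u x * \<phi> x)"
    by (rule Bochner_Integration.integrable_bound[OF int]) (use u \<phi> le M0 in \<open>auto simp: abs_mult\<close>)
  have "\<bar>integral\<^sup>L \<mu> (\<lambda>x. u x * \<phi> x)\<bar> \<le> integral\<^sup>L \<mu> (\<lambda>x. \<bar>u x * \<phi> x\<bar>)"
    by (rule integral_abs_bound)
  also have "\<dots> \<le> integral\<^sup>L \<mu> (\<lambda>x. M * \<bar>u x\<bar>)"
    using i int le by (intro integral_mono) auto
  finally show "\<bar>integral\<^sup>L \<mu> (\<lambda>x. u x * \<phi> x)\<bar> \<le> M * integral\<^sup>L \<mu> (\<lambda>x. \<bar>u x\<bar>)"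
    by simp
qed

lemma integrable_mult_test:
  assumes "integrable \<mu> u" "test_fun \<Omega> \<phi>"
  shows "integrable \<mu> (\<lambda>x. u x * \<phi> x)"
proof -
  obtain M where "\<And>x. \<bar>\<phi> x\<bar> \<le> M" using test_fun_bounded[OF assms(2)] by blast
  then show ?thesis using assms by (intro integrable_mult_bounded test_fun_measurable)
qed

section \<open>Linear structure of the Sobolev spaces\<close>

lemma weak_d1_lincomb:
  assumes L2: "L2 \<Omega> u" "L2 \<Omega> v" "L2 \<Omega> w" "L2 \<Omega> w'" and w: "weak_d1 \<Omega> u i w" "weak_d1 \<Omega> v i w'"
  shows "weak_d1 \<Omega> (\<lambda>x. u x + c * v x) i (\<lambda>x. w x + c * w' x)"
  unfolding weak_d1_def
proof (intro allI impI)
  fix \<phi> assume \<phi>: "test_fun \<Omega> \<phi>"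
  note int = integrable_mult_test[OF L2(1)[THEN L2_integrable] test_fun_pd[OF \<phi>]]
    integrable_mult_test[OF L2(2)[THEN L2_integrable] test_fun_pd[OF \<phi>]]
    integrable_mult_test[OF L2(3)[THEN L2_integrable] \<phi>]
    integrable_mult_test[OF L2(4)[THEN L2_integrable] \<phi>]
  show "integral\<^sup>L \<mu> (\<lambda>x. (u x + c * v x) * pd i \<phi> x) = - integral\<^sup>L \<mu> (\<lambda>x. (w x + c * w' x) * \<phi> x)"
    using int w \<phi> by (simp add: distrib_right mult.assoc weak_d1_def)
qed

lemma weak_d2_lincomb:
  assumes L2: "L2 \<Omega> u" "L2 \<Omega> v" "L2 \<Omega> w" "L2 \<Omega> w'" and w: "weak_d2 \<Omega> u i j w" "weak_d2 \<Omega> v i j w'"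
  shows "weak_d2 \<Omega> (\<lambda>x. u x + c * v x) i j (\<lambda>x. w x + c * w' x)"
  unfolding weak_d2_def
proof (intro allI impI)
  fix \<phi> assume \<phi>: "test_fun \<Omega> \<phi>"
  note int = integrable_mult_test[OF L2(1)[THEN L2_integrable] test_fun_pd[OF test_fun_pd[OF \<phi>]]]
    integrable_mult_test[OF L2(2)[THEN L2_integrable] test_fun_pd[OF test_fun_pd[OF \<phi>]]]
    integrable_mult_test[OF L2(3)[THEN L2_integrable] \<phi>]
    integrable_mult_test[OF L2(4)[THEN L2_integrable] \<phi>]
  show "integral\<^sup>L \<mu> (\<lambda>x. (u x + c * v x) * pd i (pd j \<phi>) x) = integral\<^sup>L \<mu> (\<lambda>x. (w x + c * w' x) * \<phi> x)"
    using int w \<phi> by (simp add: distrib_right mult.assoc weak_d2_def)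
qed

lemma H1_lincomb:
  assumes "H1 \<Omega> u" "H1 \<Omega> v"
  shows "H1 \<Omega> (\<lambda>x. u x + c * v x)"
  unfolding H1_def
proof (intro conjI allI)
  show "L2 \<Omega> (\<lambda>x. u x + c * v x)" using assms by (simp add: H1_def L2_lincomb)
  fix i
  obtain w w' where "L2 \<Omega> w" "weak_d1 \<Omega> u i w" "L2 \<Omega> w'" "weak_d1 \<Omega> v i w'"
    using assms unfolding H1_def by blast
  then have "L2 \<Omega> (\<lambda>x. w x + c * w' x)" "weak_d1 \<Omega> (\<lambda>x. u x + c * v x) i (\<lambda>x. w x + c * w' x)"
    using assms by (simp_all add: H1_def L2_lincomb weak_d1_lincomb)
  then show "\<exists>w. L2 \<Omega> w \<and> weak_d1 \<Omega> (\<lambda>x. u x + c * v x) i w" by blast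
qed

lemma H2_lincomb:
  assumes "H2 \<Omega> u" "H2 \<Omega> v"
  shows "H2 \<Omega> (\<lambda>x. u x + c * v x)"
  unfolding H2_def
proof (intro conjI allI)
  show "H1 \<Omega> (\<lambda>x. u x + c * v x)" using assms by (simp add: H2_def H1_lincomb)
  fix i j
  obtain w w' where "L2 \<Omega> w" "weak_d2 \<Omega> u i j w" "L2 \<Omega> w'" "weak_d2 \<Omega> v i j w'"
    using assms unfolding H2_def by blast
  then have "L2 \<Omega> (\<lambda>x. w x + c * w' x)" "weak_d2 \<Omega> (\<lambda>x. u x + c * v x) i j (\<lambda>x. w x + c * w' x)"
    using assms by (simp_all add: H2_def H1_def L2_lincomb weak_d2_lincomb)
  then show "\<exists>w. L2 \<Omega> w \<and> weak_d2 \<Omega> (\<lambda>x. u x + c * v x) i j w" by blast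
qed

text \<open>Comes from \<open>(p + q)^2 <= 2 p^2 + 2 q^2\<close>. In terms of squared distances it
  plays the part of the triangle inequality when two approximating sequences of test functions are
  combined in \<open>H10\<close>.\<close>

lemma L2_dist_lincomb:
  assumes "L2 \<Omega> u" "L2 \<Omega> v" "test_fun \<Omega> \<phi>" "test_fun \<Omega> \<psi>"
  shows "integral\<^sup>L \<mu> (\<lambda>x. (u x + c * v x - (\<phi> x + c * \<psi> x))\<^sup>2)
    \<le> 2 * integral\<^sup>L \<mu> (\<lambda>x. (u x - \<phi> x)\<^sup>2) + 2 * c\<^sup>2 * integral\<^sup>L \<mu> (\<lambda>x. (v x - \<psi> x)\<^sup>2)"
proof -
  have L2t: "L2 \<Omega> \<phi>" if t: "test_fun \<Omega> \<phi>" for \<phi>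
  proof -
    obtain M where M: "\<And>x. \<bar>\<phi> x\<bar> \<le> M" using test_fun_bounded[OF t] by blast
    have "integrable \<mu> \<phi>"
      using integrable_mult_test[OF integrable_const_\<mu>[of 1] t] by simp
    from integrable_mult_test[OF this t] test_fun_measurable[OF t] show ?thesis
      by (simp add: L2_def power2_eq_square)
  qed
  have d: "L2 \<Omega> (\<lambda>x. u x - \<phi> x)" "L2 \<Omega> (\<lambda>x. v x - \<psi> x)"
    using L2_lincomb[of u \<phi> "-1"] L2_lincomb[of v \<psi> "-1"] assms L2t by auto
  have "integral\<^sup>L \<mu> (\<lambda>x. (u x + c * v x - (\<phi> x + c * \<psi> x))\<^sup>2)
     = integral\<^sup>L \<mu> (\<lambda>x. ((u x - \<phi> x) + c * (v x - \<psi> x))\<^sup>2)"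
    by (simp add: algebra_simps)
  also have "\<dots> \<le> integral\<^sup>L \<mu> (\<lambda>x. 2 * (u x - \<phi> x)\<^sup>2 + 2 * c\<^sup>2 * (v x - \<psi> x)\<^sup>2)"
  proof (rule integral_mono)
    show "integrable \<mu> (\<lambda>x. ((u x - \<phi> x) + c * (v x - \<psi> x))\<^sup>2)"
      using L2_lincomb[OF d, of c] by (simp add: L2_def)
    show "integrable \<mu> (\<lambda>x. 2 * (u x - \<phi> x)\<^sup>2 + 2 * c\<^sup>2 * (v x - \<psi> x)\<^sup>2)"
      using d by (auto simp: L2_def)
    fix x
    have "0 \<le> ((u x - \<phi> x) - c * (v x - \<psi> x))\<^sup>2" by simp
    then show "((u x - \<phi> x) + c * (v x - \<psi> x))\<^sup>2 \<le> 2 * (u x - \<phi> x)\<^sup>2 + 2 * c\<^sup>2 * (v x - \<psi> x)\<^sup>2"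
      by (simp add: power2_eq_square algebra_simps)
  qed
  also have "\<dots> = 2 * integral\<^sup>L \<mu> (\<lambda>x. (u x - \<phi> x)\<^sup>2) + 2 * c\<^sup>2 * integral\<^sup>L \<mu> (\<lambda>x. (v x - \<psi> x)\<^sup>2)"
    using d by (simp add: L2_def)
  finally show ?thesis .
qed

lemma pd_lincomb:
  assumes "test_fun \<Omega> \<phi>" "test_fun \<Omega> \<psi>"
  shows "pd i (\<lambda>x. \<phi> x + c * \<psi> x) = (\<lambda>x. pd i \<phi> x + c * pd i \<psi> x)"
proof
  fix x
  have d: "\<phi> differentiable (at x)" "\<psi> differentiable (at x)"
    using assms by (auto simp: test_fun_def intro: smooth_differentiable)
  then show "pd i (\<lambda>x. \<phi> x + c * \<psi> x) x = pd i \<phi> x + c * pd i \<psi> x"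
    by (simp add: pd_add pd_cmult differentiable_mult)
qed

lemma H10_lincomb:
  assumes u: "H10 \<Omega> u" and v: "H10 \<Omega> v"
  shows "H10 \<Omega> (\<lambda>x. u x + c * v x)"
proof -
  define E where "E u w \<phi> = integral\<^sup>L \<mu> (\<lambda>x. (u x - \<phi> x)^2)
            + (\<Sum>i\<in>UNIV. integral\<^sup>L \<mu> (\<lambda>x. (w i x - pd i \<phi> x)^2))" for u :: pfun and w :: "2 \<Rightarrow> pfun" and \<phi>
  obtain w \<phi> where w: "\<And>i. L2 \<Omega> (w i)" "\<And>i. weak_d1 \<Omega> u i (w i)" and \<phi>: "\<And>n::nat. test_fun \<Omega> (\<phi> n)"
    and lim: "(\<lambda>n. E u w (\<phi> n)) \<longlonglongrightarrow> 0"
    using u unfolding H10_def E_def by blast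
  obtain w' \<psi> where w': "\<And>i. L2 \<Omega> (w' i)" "\<And>i. weak_d1 \<Omega> v i (w' i)" and \<psi>: "\<And>n::nat. test_fun \<Omega> (\<psi> n)"
    and lim': "(\<lambda>n. E v w' (\<psi> n)) \<longlonglongrightarrow> 0"
    using v unfolding H10_def E_def by blast
  have L2: "L2 \<Omega> u" "L2 \<Omega> v" using u v by (auto simp: H10_def H1_def)
  let ?u = "\<lambda>x. u x + c * v x" and ?w = "\<lambda>i x. w i x + c * w' i x" and ?\<phi> = "\<lambda>n x. \<phi> n x + c * \<psi> n x"
  have le: "E ?u ?w (?\<phi> n) \<le> 2 * E u w (\<phi> n) + 2 * c\<^sup>2 * E v w' (\<psi> n)" for n
  proof -
    have "(\<Sum>i\<in>UNIV. integral\<^sup>L \<mu> (\<lambda>x. (?w i x - pd i (?\<phi> n) x)^2)) \<le>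
      (\<Sum>i\<in>UNIV. 2 * integral\<^sup>L \<mu> (\<lambda>x. (w i x - pd i (\<phi> n) x)\<^sup>2) + 2 * c\<^sup>2 * integral\<^sup>L \<mu> (\<lambda>x. (w' i x - pd i (\<psi> n) x)\<^sup>2))"
      using w w' \<phi> \<psi> by (intro sum_mono) (auto simp: pd_lincomb intro!: L2_dist_lincomb test_fun_pd)
    with L2_dist_lincomb[OF L2 \<phi> \<psi>, of c n n] show ?thesis
      unfolding E_def by (simp add: sum.distrib sum_distrib_left distrib_left)
  qed
  have lim2: "(\<lambda>n. 2 * E u w (\<phi> n) + 2 * c\<^sup>2 * E v w' (\<psi> n)) \<longlonglongrightarrow> 0"
    using tendsto_add[OF tendsto_mult_left[OF lim, of 2] tendsto_mult_left[OF lim', of "2 * c\<^sup>2"]] by simp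
  have nonneg: "E u w \<phi> \<ge> 0" for u w \<phi> by (simp add: E_def sum_nonneg)
  have "(\<lambda>n. E ?u ?w (?\<phi> n)) \<longlonglongrightarrow> 0"
    by (rule tendsto_sandwich[OF always_eventually always_eventually tendsto_const lim2])
       (simp_all only: nonneg le simp_thms)
  moreover have "\<forall>n. test_fun \<Omega> (?\<phi> n)" using \<phi> \<psi> by (simp add: test_fun_add test_fun_cmult)
  ultimately have "(\<forall>n. test_fun \<Omega> (?\<phi> n)) \<and> (\<lambda>n. E ?u ?w (?\<phi> n)) \<longlonglongrightarrow> 0"
    by (rule conjI[rotated])
  then have approx: "\<exists>\<phi>. (\<forall>n. test_fun \<Omega> (\<phi> n)) \<and> (\<lambda>n. E ?u ?w (\<phi> n)) \<longlonglongrightarrow> 0"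
    by (rule exI[of _ ?\<phi>])
  have deriv: "\<forall>i. L2 \<Omega> (?w i) \<and> weak_d1 \<Omega> ?u i (?w i)"
    using L2 w w' by (simp add: L2_lincomb weak_d1_lincomb)
  have "H1 \<Omega> ?u" using u v by (simp add: H10_def H1_lincomb)
  moreover have "\<exists>w. (\<forall>i. L2 \<Omega> (w i) \<and> weak_d1 \<Omega> ?u i (w i)) \<and>
      (\<exists>\<phi>. (\<forall>n. test_fun \<Omega> (\<phi> n)) \<and> (\<lambda>n. E ?u w (\<phi> n)) \<longlonglongrightarrow> 0)"
    by (rule exI[of _ ?w], rule conjI[OF deriv approx])
  ultimately show ?thesis unfolding H10_def E_def by (rule conjI)
qed

lemma Xsp_lincomb: "u \<in> Xsp \<Omega> \<Longrightarrow> v \<in> Xsp \<Omega> \<Longrightarrow> (\<lambda>x. u x + c * v x) \<in> Xsp \<Omega>"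
  by (simp add: Xsp_def H2_lincomb H10_lincomb)

text \<open>Representatives are arbitrary outside \<open>\<Omega>\<close>; cutting them off there
  makes them integrable on the whole plane, as Lebesgue differentiation requires.\<close>

definition ext0 :: "pfun \<Rightarrow> pfun" where
  "ext0 u x = (if x \<in> \<Omega> then u x else 0)"

lemma ext0_absolutely_integrable: "integrable \<mu> u \<Longrightarrow> ext0 u absolutely_integrable_on UNIV"
  using absolutely_integrable_restrict_UNIV[of \<Omega> u] sets_\<Omega>
  by (simp add: ext0_def[abs_def] absolutely_integrable_on_def[symmetric] set_integrable_def integrable_restrict_space)

lemma AE_\<mu>I:
  assumes "negligible N" "\<And>x. x \<in> \<Omega> \<Longrightarrow> x \<notin> N \<Longrightarrow> P x"
  shows "AE x in \<mu>. P x"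
proof -
  have "AE x in lebesgue. x \<notin> N"
    using assms(1) by (simp add: negligible_iff_null_sets AE_not_in)
  then show ?thesis using sets_\<Omega> assms(2) by (subst AE_restrict_space_iff) auto
qed

end

section \<open>Averages over parallelograms as limits of integrals against test functions\<close>

locale framed_domain = bounded_open + dual_frame
begin

text \<open>Transfers a bound from product bumps to the characteristic function of a parallelogram:
  dominated convergence with majorant \<open>\<bar>u x\<bar>\<close> produces the open
  parallelogram, which differs from the closed one only by points on four lines.\<close>

lemma integral_pgram_le:
  assumes u: "integrable \<mu> u" and sub: "pgram A B A' B' \<subseteq> \<Omega>"
    and le: "\<And>n. \<bar>integral\<^sup>L \<mu> (\<lambda>x. u x * tensor (bump A B n) (bump A' B' n) x)\<bar> \<le> C"
  shows "\<bar>integral (pgram A B A' B') (ext0 u)\<bar> \<le> C"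
proof -
  let ?P = "pgram A B A' B'"
  let ?i = "\<lambda>x. indicator {A<..<B} (a \<bullet> x) * indicator {A'<..<B'} (b \<bullet> x) :: real"
  have meas: "(\<lambda>x. \<alpha> (c \<bullet> x)) \<in> borel_measurable \<mu>" if "\<alpha> \<in> borel_measurable borel" for c and \<alpha> :: "real \<Rightarrow> real"
  proof -
    have "(\<lambda>x. c \<bullet> x) \<in> borel_measurable \<mu>"
      by (intro continuous_imp_measurable_on_sets_lebesgue sets_\<Omega>) (auto intro: continuous_intros)
    from measurable_compose[OF this that] show ?thesis .
  qed
  have "(\<lambda>n. integral\<^sup>L \<mu> (\<lambda>x. u x * tensor (bump A B n) (bump A' B' n) x)) \<longlonglongrightarrow> integral\<^sup>L \<mu> (\<lambda>x. u x * ?i x)"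
  proof (rule integral_dominated_convergence[where w="\<lambda>x. \<bar>u x\<bar>"])
    show "(\<lambda>x. u x * ?i x) \<in> borel_measurable \<mu>"
      using u by (intro borel_measurable_times meas) auto
    show "(\<lambda>x. u x * tensor (bump A B n) (bump A' B' n) x) \<in> borel_measurable \<mu>" for n
      unfolding tensor_def using u
      by (intro borel_measurable_times meas) (auto intro!: borel_measurable_continuous_onI smooth1_continuous smooth1_bump)
    show "AE x in \<mu>. (\<lambda>n. u x * tensor (bump A B n) (bump A' B' n) x) \<longlonglongrightarrow> u x * ?i x"
      unfolding tensor_def by (intro AE_I2 tendsto_mult tendsto_const bump_tendsto)
    show "AE x in \<mu>. norm (u x * tensor (bump A B n) (bump A' B' n) x) \<le> \<bar>u x\<bar>" for n
      unfolding tensor_def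
      by (intro AE_I2) (auto simp: abs_mult bump_nonneg bump_le_1 intro!: mult_right_le_one_le mult_le_one)
  qed (use u in auto)
  then have "\<bar>integral\<^sup>L \<mu> (\<lambda>x. u x * ?i x)\<bar> \<le> C"
    using le by (intro LIMSEQ_le_const2[OF tendsto_rabs]) auto
  also have "integral\<^sup>L \<mu> (\<lambda>x. u x * ?i x) = integral\<^sup>L \<mu> (\<lambda>x. indicator ?P x * u x)"
  proof (rule integral_cong_AE)
    have nz: "a \<noteq> 0" "b \<noteq> 0" using ad be by auto
    let ?N = "{x. a \<bullet> x = A} \<union> {x. a \<bullet> x = B} \<union> {x. b \<bullet> x = A'} \<union> {x. b \<bullet> x = B'}"
    show "AE x in \<mu>. u x * ?i x = indicator ?P x * u x"
      by (rule AE_\<mu>I[of ?N])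
         (use nz in \<open>auto simp: pgram_def indicator_def intro!: negligible_Un negligible_hyperplane\<close>)
    show "(\<lambda>x. u x * ?i x) \<in> borel_measurable \<mu>"
      using u by (intro borel_measurable_times meas) auto
    have "?P \<in> sets \<mu>" using sub sets_\<Omega> lmeasurable_compact[OF compact_pgram]
      by (auto simp: sets_restrict_space_iff)
    then show "(\<lambda>x. indicator ?P x * u x) \<in> borel_measurable \<mu>"
      using u by auto
  qed
  also have "\<dots> = integral\<^sup>L lebesgue (\<lambda>x. indicator ?P x * ext0 u x)"
    using sets_\<Omega> sub by (subst integral_restrict_space) (auto simp: ext0_def indicator_def intro!: Bochner_Integration.integral_cong)
  also have "\<dots> = integral ?P (ext0 u)"
  proof -
    have "ext0 u absolutely_integrable_on ?P"
      using ext0_absolutely_integrable[OF u] lmeasurable_compact[OF compact_pgram]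
      by (rule set_integrable_subset[OF _ fmeasurableD]) auto
    from set_lebesgue_integral_eq_integral(2)[OF this] show ?thesis
      by (simp add: set_lebesgue_integral_def)
  qed
  finally show ?thesis .
qed

lemma pgram_small:
  assumes "y \<in> \<Omega>"
  shows "\<exists>\<delta>>0. \<forall>t. 0 < t \<and> t < \<delta> \<longrightarrow> pgram (a \<bullet> y) (a \<bullet> y + t) (b \<bullet> y) (b \<bullet> y + t) \<subseteq> \<Omega>"
proof -
  obtain r where r: "r > 0" "ball y r \<subseteq> \<Omega>" using open_\<Omega> assms open_contains_ball by blast
  let ?\<delta> = "r / (norm d + norm e + 1)"
  have "?\<delta> > 0" using r by (auto intro!: divide_pos_pos add_nonneg_pos)
  moreover have "x \<in> \<Omega>" if t: "0 < t" "t < ?\<delta>" and x: "x \<in> pgram (a \<bullet> y) (a \<bullet> y + t) (b \<bullet> y) (b \<bullet> y + t)" for t x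
  proof -
    have "norm (x - y) \<le> t * (norm d + norm e)" using x by (rule pgram_norm_le)
    also have "\<dots> \<le> t * (norm d + norm e + 1)" using t by (simp add: algebra_simps)
    also have "\<dots> < r"
      using t(2) pos_less_divide_eq[of "norm d + norm e + 1" t r] by (auto simp: add_nonneg_pos)
    finally show ?thesis using r(2) by (auto simp: dist_norm norm_minus_commute)
  qed
  ultimately show ?thesis by blast
qed

end

section \<open>The fundamental lemma and uniqueness of weak second derivatives\<close>

context bounded_open begin

lemma standard_framed_domain: "framed_domain \<Omega> (axis 1 1) (axis 2 1) (axis 1 1) (axis 2 1)"
  using standard_dual_frame by (intro framed_domain.intro bounded_open_axioms)

text \<open>The fundamental lemma of the calculus of variations. Product bumps show that the
  integral over every small square with a corner in \<open>\<Omega>\<close> vanishes, and Lebesgue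
  differentiation with the constant 0 finishes.\<close>

lemma test_fun_integral_0_imp_AE:
  assumes f: "integrable \<mu> f" and 0: "\<And>\<phi>. test_fun \<Omega> \<phi> \<Longrightarrow> integral\<^sup>L \<mu> (\<lambda>x. f x * \<phi> x) = 0"
  shows "AE x in \<mu>. f x = 0"
proof -
  let ?a = "axis 1 1 :: real^2" and ?b = "axis 2 1 :: real^2"
  interpret std: framed_domain \<Omega> ?a ?b ?a ?b by (rule standard_framed_domain)
  have "\<exists>\<delta>>0. \<forall>t. 0 < t \<and> t < \<delta> \<longrightarrow>
        \<bar>integral (std.pgram (?a \<bullet> y) (?a \<bullet> y + t) (?b \<bullet> y) (?b \<bullet> y + t)) (ext0 f)\<bar> \<le> 0 * t^2" if y: "y \<in> \<Omega>" for y
  proof -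
    obtain \<delta> where \<delta>: "\<delta> > 0" "\<And>t. 0 < t \<and> t < \<delta> \<Longrightarrow> std.pgram (?a \<bullet> y) (?a \<bullet> y + t) (?b \<bullet> y) (?b \<bullet> y + t) \<subseteq> \<Omega>"
      using std.pgram_small[OF y] by blast
    have "\<bar>integral (std.pgram (?a \<bullet> y) (?a \<bullet> y + t) (?b \<bullet> y) (?b \<bullet> y + t)) (ext0 f)\<bar> \<le> 0" if "0 < t" "t < \<delta>" for t
    proof (rule std.integral_pgram_le[OF f])
      show sub: "std.pgram (?a \<bullet> y) (?a \<bullet> y + t) (?b \<bullet> y) (?b \<bullet> y + t) \<subseteq> \<Omega>"
        using \<delta>(2) that by blast
      have "test_fun \<Omega> (std.tensor (bump (?a \<bullet> y) (?a \<bullet> y + t) n) (bump (?b \<bullet> y) (?b \<bullet> y + t) n))" for n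
        using sub by (rule std.test_fun_tensor[OF smooth1_bump smooth1_bump]) (auto intro: bump_eq_0)
      from 0[OF this] show "\<bar>integral\<^sup>L \<mu> (\<lambda>x. f x * std.tensor (bump (?a \<bullet> y) (?a \<bullet> y + t) n) (bump (?b \<bullet> y) (?b \<bullet> y + t) n) x)\<bar> \<le> 0" for n
        by simp
    qed
    then show ?thesis using \<delta>(1) by auto
  qed
  from std.lebesgue_differentiation_bound[OF ext0_absolutely_integrable[OF f] this]
  obtain N where "negligible N" "\<And>x. x \<in> \<Omega> \<Longrightarrow> x \<notin> N \<Longrightarrow> \<bar>ext0 f x\<bar> \<le> 0 / std.jac"
    by blast
  then show ?thesis by (intro AE_\<mu>I) (auto simp: ext0_def)
qed

lemma weak_d2_unique:
  assumes "L2 \<Omega> w" "L2 \<Omega> w'" "weak_d2 \<Omega> u i j w" "weak_d2 \<Omega> u i j w'"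
  shows "AE x in \<mu>. w x = w' x"
proof -
  have "AE x in \<mu>. w x - w' x = 0"
  proof (rule test_fun_integral_0_imp_AE)
    show "integrable \<mu> (\<lambda>x. w x - w' x)" using assms by (auto intro: L2_integrable)
    fix \<phi> assume \<phi>: "test_fun \<Omega> \<phi>"
    show "integral\<^sup>L \<mu> (\<lambda>x. (w x - w' x) * \<phi> x) = 0"
      using assms \<phi> integrable_mult_test[OF L2_integrable \<phi>, of w] integrable_mult_test[OF L2_integrable \<phi>, of w']
      by (simp add: left_diff_distrib weak_d2_def)
  qed
  then show ?thesis by simp
qed

lemma D2_spec:
  assumes "H2 \<Omega> u"
  shows "L2 \<Omega> (D2 \<Omega> u i j)" "weak_d2 \<Omega> u i j (D2 \<Omega> u i j)"
  using someI_ex[of "\<lambda>w. L2 \<Omega> w \<and> weak_d2 \<Omega> u i j w"] assms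
  unfolding D2_def H2_def by blast+

text \<open>Both sides are weak second derivatives in \<open>L2\<close> of the same function, but
  \<open>D2\<close> picks its representatives independently, so equality can be claimed only almost
  everywhere.\<close>

lemma D2_lincomb:
  assumes "H2 \<Omega> u" "H2 \<Omega> v"
  shows "AE x in \<mu>. D2 \<Omega> (\<lambda>x. u x + c * v x) i j x = D2 \<Omega> u i j x + c * D2 \<Omega> v i j x"
  using assms
  by (intro weak_d2_unique[where u="\<lambda>x. u x + c * v x" and i=i and j=j] L2_lincomb weak_d2_lincomb
      D2_spec H2_lincomb) (auto simp: H2_def H1_def)

end

subsection \<open>Functions with second weak derivatives are locally bounded\<close>

text \<open>A bump divided by its integral, which is nonzero because the bump is continuous,
  nonnegative and positive at the midpoint. It supplies the profile that absorbs the mean in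
  \<open>ramp\<close>.\<close>

lemma normalized_bump:
  assumes "A < (B::real)"
  obtains \<psi> K where "smooth1 \<psi>" "\<And>s. s \<notin> {A..B} \<Longrightarrow> \<psi> s = 0" "\<And>s. \<bar>\<psi> s\<bar> \<le> K" "(\<psi> has_integral 1) {A..B}"
proof -
  let ?b = "bump A B 1"
  define c where "c = integral {A..B} ?b"
  have int: "?b integrable_on {A..B}"
    by (intro integrable_continuous_real smooth1_continuous smooth1_bump)
  have "c \<noteq> 0"
  proof
    assume "c = 0"
    then have "(?b has_integral 0) (cbox A B)"
      using int by (simp add: c_def has_integral_integral)
    moreover have "(A + B) / 2 \<in> cbox A B" using assms by auto
    ultimately have "?b ((A + B) / 2) = 0"
      by (intro has_integral_0_cbox_imp_0[of A B ?b])
         (use assms in \<open>auto simp: bump_nonneg intro!: smooth1_continuous smooth1_bump\<close>)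
    then show False using bump_pos[of A "(A + B) / 2" B 1] assms by simp
  qed
  moreover have "c \<ge> 0" unfolding c_def using int by (intro integral_nonneg) (auto simp: bump_nonneg)
  ultimately have c: "c > 0" by simp
  show thesis
  proof (rule that[of "\<lambda>s. (1/c) * ?b s" "1 / c"])
    show "smooth1 (\<lambda>s. (1/c) * ?b s)" by (intro smooth1_cmult smooth1_bump)
    show "(1/c) * ?b s = 0" if "s \<notin> {A..B}" for s using that bump_eq_0[of s A B 1] by auto
    show "\<bar>(1/c) * ?b s\<bar> \<le> 1 / c" for s
      using c bump_le_1[of A B 1 s] bump_nonneg[of A B 1 s] by (simp add: divide_right_mono)
    show "((\<lambda>s. (1/c) * ?b s) has_integral 1) {A..B}"
      using has_integral_mult_right[OF integrable_integral[OF int], of "1/c"] c by (simp add: c_def)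
  qed
qed

text \<open>Correcting \<open>\<beta>\<close> by a multiple of the fixed profile \<open>\<psi>\<close> makes its mean vanish, so that its
  primitive \<open>\<eta>\<close> has compact support.\<close>
lemma ramp:
  fixes h t A K :: real
  assumes h: "0 < t" "t < h / 2" and \<beta>: "smooth1 \<beta>" "\<And>s. s \<notin> {A..A+t} \<Longrightarrow> \<beta> s = 0" "\<And>s. 0 \<le> \<beta> s" "\<And>s. \<beta> s \<le> 1"
    and \<psi>: "smooth1 \<psi>" "\<And>s. s \<notin> {h/2..h} \<Longrightarrow> \<psi> s = 0" "\<And>s. \<bar>\<psi> s\<bar> \<le> K" "(\<psi> has_integral 1) {h/2..h}"
  obtains \<eta> I where "smooth1 \<eta>" "\<And>s. s \<notin> {A..A+h} \<Longrightarrow> \<eta> s = 0" "0 \<le> I" "I \<le> t"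
    "\<And>s. \<bar>\<eta> s\<bar> \<le> t * (1 + h * K)" "\<And>s. \<beta> s = deriv \<eta> s + I * \<psi> (s - A)"
proof -
  define I where "I = integral {A..A+h} \<beta>"
  define g where "g s = \<beta> s - I * \<psi> (s - A)" for s
  \<comment> \<open>The integration starts one unit left of the support, so that
    \<open>s = A\<close> is interior to the interval and the fundamental theorem yields a two-sided
    derivative there.\<close>
  define \<eta> where "\<eta> s = integral {A-1..s} g" for s
  have sm\<psi>: "smooth1 (\<lambda>s. \<psi> (s - A))" using smooth1_affine[OF \<psi>(1), of 1 "- A"] by simp
  have smg: "smooth1 g" unfolding g_def[abs_def] by (intro smooth1_diff smooth1_cmult \<beta>(1) sm\<psi>)
  have int: "f integrable_on {x..y}" if "smooth1 f" for f x y
    using that by (intro integrable_continuous_real smooth1_continuous)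
  have g0: "g s = 0" if "s \<notin> {A..A+h}" for s
    using that h \<beta>(2)[of s] \<psi>(2)[of "s - A"] by (auto simp: g_def)
  have I\<beta>: "I = integral {A..A+t} \<beta>"
  proof -
    have "integral {A..A+t} \<beta> + integral {A+t..A+h} \<beta> = I"
      unfolding I_def using h by (intro Henstock_Kurzweil_Integration.integral_combine int \<beta>(1)) auto
    moreover have "integral {A+t..A+h} \<beta> = integral {A+t..A+h} (\<lambda>_. 0)"
      by (rule integral_spike[of "{A+t}"]) (use \<beta>(2) in auto)
    ultimately show ?thesis by simp
  qed
  have I0: "0 \<le> I" unfolding I_def by (intro integral_nonneg int \<beta>)
  have It: "I \<le> t"
  proof -
    have "integral {A..A+t} \<beta> \<le> integral {A..A+t} (\<lambda>_. 1)"
      by (intro integral_le int \<beta> smooth1_const)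
    then show ?thesis using I\<beta> h by simp
  qed
  have \<psi>int: "((\<lambda>s. \<psi> (s - A)) has_integral 1) {A+h/2..A+h}"
    using has_integral_affinity[of \<psi> 1 "h/2" h 1 "- A"] \<psi>(4) by (simp add: add.commute)
  have gint: "integral {A..A+h} g = 0"
  proof -
    have "((\<lambda>s. \<psi> (s - A)) has_integral (0 + 1)) {A..A+h}"
    proof (rule has_integral_combine[of A "A+h/2"])
      show "((\<lambda>s. \<psi> (s - A)) has_integral 0) {A..A + h/2}"
        by (rule has_integral_spike[where S="{A+h/2}" and f="\<lambda>_. 0"]) (use \<psi>(2) in auto)
    qed (use h \<psi>int in auto)
    then have "integral {A..A+h} (\<lambda>s. \<psi> (s - A)) = 1" by (simp add: integral_unique)
    then show ?thesis unfolding g_def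
      using int[OF \<beta>(1)] int[OF smooth1_cmult[OF sm\<psi>, of I]]
      by (simp add: Henstock_Kurzweil_Integration.integral_diff I_def)
  qed
  have \<eta>0: "\<eta> s = 0" if "s \<le> A" for s
  proof -
    have "\<eta> s = integral {A-1..s} (\<lambda>_. 0)" unfolding \<eta>_def
      by (rule integral_spike[of "{A}"]) (use that g0 in auto)
    then show ?thesis by simp
  qed
  have \<eta>A: "\<eta> s = integral {A..s} g" if "A \<le> s" for s
  proof -
    have "integral {A-1..A} g + integral {A..s} g = \<eta> s"
      unfolding \<eta>_def using that by (intro Henstock_Kurzweil_Integration.integral_combine int smg) auto
    then show ?thesis using \<eta>0[of A] by (simp add: \<eta>_def)
  qed
  have \<eta>1: "\<eta> s = 0" if "A + h \<le> s" for s
  proof -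
    have "integral {A..A+h} g + integral {A+h..s} g = integral {A..s} g"
      using that h by (intro Henstock_Kurzweil_Integration.integral_combine int smg) auto
    moreover have "integral {A+h..s} g = integral {A+h..s} (\<lambda>_. 0)"
      by (rule integral_spike[of "{A+h}"]) (use g0 in auto)
    ultimately show ?thesis using \<eta>A[of s] gint that h by simp
  qed
  have d: "(\<eta> has_real_derivative g s) (at s)" for s
  proof (cases "s < A")
    case True
    have "((\<lambda>_. 0) has_real_derivative g s) (at s)" using g0[of s] True by simp
    then show ?thesis
      by (rule has_field_derivative_transform_within_open[of _ _ _ "{..<A}"]) (use True \<eta>0 in auto)
  next
    case False
    have "(\<eta> has_real_derivative g s) (at s within {A-1..s+1})"
      unfolding \<eta>_def using False by (intro integral_has_real_derivative smooth1_continuous smg) auto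
    moreover have "at s within {A-1..s+1} = at s"
      using False by (intro at_within_interior) auto
    ultimately show ?thesis by simp
  qed
  have K: "K \<ge> 0" using \<psi>(3)[of 0] by linarith
  \<comment> \<open>The point is the factor \<open>t\<close>: both the primitive of
    \<open>\<beta>\<close> and the mass \<open>I\<close> are at most \<open>t\<close>, while the
    part coming from \<open>\<psi>\<close> costs only the fixed factor \<open>h * K\<close>.\<close>
  have bound: "\<bar>\<eta> s\<bar> \<le> t * (1 + h * K)" for s
  proof (cases "A \<le> s \<and> s \<le> A + h")
    case False
    then have "\<eta> s = 0" using \<eta>0[of s] \<eta>1[of s] by linarith
    then show ?thesis using h K by simp
  next
    case True
    have "\<eta> s = integral {A..s} \<beta> - I * integral {A..s} (\<lambda>s. \<psi> (s - A))"
      using \<eta>A[of s] True int[OF \<beta>(1)] int[OF smooth1_cmult[OF sm\<psi>, of I]]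
      by (simp add: g_def[abs_def] Henstock_Kurzweil_Integration.integral_diff)
    moreover have "0 \<le> integral {A..s} \<beta>" by (intro integral_nonneg int \<beta>)
    moreover have "integral {A..s} \<beta> \<le> I" unfolding I_def
      using True \<beta>(3) by (intro integral_subset_le int \<beta>) auto
    moreover have "\<bar>integral {A..s} (\<lambda>s. \<psi> (s - A))\<bar> \<le> K * (s - A)"
      using True integral_bound[of A s "\<lambda>s. \<psi> (s - A)" K] \<psi>(3) smooth1_continuous[OF sm\<psi>] by simp
    moreover have "K * (s - A) \<le> K * h" using True K by (intro mult_left_mono) auto
    ultimately have "\<bar>\<eta> s\<bar> \<le> I + I * (K * h)"
      using I0 mult_left_mono[of "\<bar>integral {A..s} (\<lambda>s. \<psi> (s - A))\<bar>" "K * h" I]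
      by (auto simp: abs_mult intro: order_trans[OF abs_triangle_ineq4])
    also have "\<dots> \<le> t + t * (K * h)" using It K h by (intro add_mono mult_right_mono) auto
    finally show ?thesis by (simp add: algebra_simps)
  qed
  have "deriv \<eta> = g" using d by (auto intro: DERIV_imp_deriv)
  moreover have "\<eta> s = 0" if "s \<notin> {A..A+h}" for s
    using that \<eta>0[of s] \<eta>1[of s] by auto
  ultimately show thesis
    using that[of \<eta> I] smooth1_antideriv[OF d smg] I0 It bound by (simp add: g_def)
qed

context framed_domain begin

text \<open>Combining the coordinate derivatives with the entries of \<open>d\<close> and
  \<open>e\<close> gives weak derivatives along the sides. Only integrability is recorded, since
  they will be paired with bounded functions.\<close>

lemma directional_weak_derivatives:
  assumes u: "H2 \<Omega> u"
  obtains wd we wde where "integrable \<mu> wd" "integrable \<mu> we" "integrable \<mu> wde"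
    "\<And>\<alpha> \<beta>. smooth1 \<alpha> \<Longrightarrow> smooth1 \<beta> \<Longrightarrow> test_fun \<Omega> (tensor \<alpha> \<beta>) \<Longrightarrow>
      integral\<^sup>L \<mu> (\<lambda>x. u x * tensor (deriv \<alpha>) \<beta> x) = - integral\<^sup>L \<mu> (\<lambda>x. wd x * tensor \<alpha> \<beta> x)"
    "\<And>\<alpha> \<beta>. smooth1 \<alpha> \<Longrightarrow> smooth1 \<beta> \<Longrightarrow> test_fun \<Omega> (tensor \<alpha> \<beta>) \<Longrightarrow>
      integral\<^sup>L \<mu> (\<lambda>x. u x * tensor \<alpha> (deriv \<beta>) x) = - integral\<^sup>L \<mu> (\<lambda>x. we x * tensor \<alpha> \<beta> x)"
    "\<And>\<alpha> \<beta>. smooth1 \<alpha> \<Longrightarrow> smooth1 \<beta> \<Longrightarrow> test_fun \<Omega> (tensor \<alpha> \<beta>) \<Longrightarrow>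
      integral\<^sup>L \<mu> (\<lambda>x. u x * tensor (deriv \<alpha>) (deriv \<beta>) x) = integral\<^sup>L \<mu> (\<lambda>x. wde x * tensor \<alpha> \<beta> x)"
proof -
  have "\<forall>i. \<exists>w. L2 \<Omega> w \<and> weak_d1 \<Omega> u i w" using u by (simp add: H2_def H1_def)
  then obtain w1 where w1: "\<And>i. L2 \<Omega> (w1 i)" "\<And>i. weak_d1 \<Omega> u i (w1 i)" by metis
  define w2 where "w2 = D2 \<Omega> u"
  have w2: "L2 \<Omega> (w2 i j)" "weak_d2 \<Omega> u i j (w2 i j)" for i j
    using D2_spec[OF u] by (auto simp: w2_def)
  have Lu: "integrable \<mu> u" using u by (auto simp: H2_def H1_def intro: L2_integrable)
  define D where "D c x = (\<Sum>i\<in>UNIV. c $ i * w1 i x)" for c :: "real^2" and x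
  have D: "integrable \<mu> (D c)" for c
    unfolding D_def[abs_def] using w1 by (intro Bochner_Integration.integrable_sum integrable_mult_right L2_integrable)
  define D' where "D' x = (\<Sum>i\<in>UNIV. \<Sum>j\<in>UNIV. d $ i * e $ j * w2 i j x)" for x
  have D': "integrable \<mu> D'"
    unfolding D'_def[abs_def] using w2 by (intro Bochner_Integration.integrable_sum integrable_mult_right L2_integrable)
  have first: "integral\<^sup>L \<mu> (\<lambda>x. u x * (\<Sum>i\<in>UNIV. c $ i * pd i \<phi> x)) = - integral\<^sup>L \<mu> (\<lambda>x. D c x * \<phi> x)"
    if \<phi>: "test_fun \<Omega> \<phi>" for c \<phi>
  proof -
    have "integral\<^sup>L \<mu> (\<lambda>x. u x * (\<Sum>i\<in>UNIV. c $ i * pd i \<phi> x))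
       = integral\<^sup>L \<mu> (\<lambda>x. \<Sum>i\<in>UNIV. c $ i * (u x * pd i \<phi> x))"
      by (simp add: sum_distrib_left mult_ac)
    also have "\<dots> = (\<Sum>i\<in>UNIV. c $ i * integral\<^sup>L \<mu> (\<lambda>x. u x * pd i \<phi> x))"
      using integrable_mult_test[OF Lu test_fun_pd[OF \<phi>]] by (simp add: Bochner_Integration.integral_sum)
    also have "\<dots> = (\<Sum>i\<in>UNIV. - (c $ i * integral\<^sup>L \<mu> (\<lambda>x. w1 i x * \<phi> x)))"
      using w1(2) \<phi> by (simp add: weak_d1_def)
    also have "\<dots> = - integral\<^sup>L \<mu> (\<lambda>x. \<Sum>i\<in>UNIV. c $ i * (w1 i x * \<phi> x))"
      using integrable_mult_test[OF L2_integrable[OF w1(1)] \<phi>]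
      by (simp add: Bochner_Integration.integral_sum sum_negf)
    also have "\<dots> = - integral\<^sup>L \<mu> (\<lambda>x. D c x * \<phi> x)"
      by (simp add: D_def sum_distrib_right mult.assoc)
    finally show ?thesis .
  qed
  have second: "integral\<^sup>L \<mu> (\<lambda>x. u x * (\<Sum>i\<in>UNIV. \<Sum>j\<in>UNIV. d $ i * e $ j * pd i (pd j \<phi>) x)) = integral\<^sup>L \<mu> (\<lambda>x. D' x * \<phi> x)"
    if \<phi>: "test_fun \<Omega> \<phi>" for \<phi>
  proof -
    have "integral\<^sup>L \<mu> (\<lambda>x. u x * (\<Sum>i\<in>UNIV. \<Sum>j\<in>UNIV. d $ i * e $ j * pd i (pd j \<phi>) x))
       = integral\<^sup>L \<mu> (\<lambda>x. \<Sum>i\<in>UNIV. \<Sum>j\<in>UNIV. d $ i * e $ j * (u x * pd i (pd j \<phi>) x))"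
      by (simp add: sum_distrib_left mult_ac)
    also have "\<dots> = (\<Sum>i\<in>UNIV. \<Sum>j\<in>UNIV. d $ i * e $ j * integral\<^sup>L \<mu> (\<lambda>x. u x * pd i (pd j \<phi>) x))"
      using integrable_mult_test[OF Lu test_fun_pd[OF test_fun_pd[OF \<phi>]]] by (simp add: Bochner_Integration.integral_sum)
    also have "\<dots> = (\<Sum>i\<in>UNIV. \<Sum>j\<in>UNIV. d $ i * e $ j * integral\<^sup>L \<mu> (\<lambda>x. w2 i j x * \<phi> x))"
      using w2(2) \<phi> by (simp add: weak_d2_def)
    also have "\<dots> = integral\<^sup>L \<mu> (\<lambda>x. \<Sum>i\<in>UNIV. \<Sum>j\<in>UNIV. d $ i * e $ j * (w2 i j x * \<phi> x))"
      using integrable_mult_test[OF L2_integrable[OF w2(1)] \<phi>]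
      by (simp add: Bochner_Integration.integral_sum)
    also have "\<dots> = integral\<^sup>L \<mu> (\<lambda>x. D' x * \<phi> x)"
      by (simp add: D'_def sum_distrib_right mult.assoc)
    finally show ?thesis .
  qed
  show thesis
    by (rule that[of "D d" "D e" D'])
       (use D D' first[of _ d] first[of _ e] second in
         \<open>simp_all flip: sum_d_pd_tensor sum_e_pd_tensor sum_de_pd_tensor\<close>)
qed

lemma tensor_le:
  assumes "\<And>s. \<bar>\<alpha> s\<bar> \<le> P" "\<And>s. \<bar>\<beta> s\<bar> \<le> Q"
  shows "\<bar>tensor \<alpha> \<beta> x\<bar> \<le> P * Q"
  unfolding tensor_def abs_mult using assms order_trans[OF abs_ge_zero assms(1)] by (intro mult_mono) auto

text \<open>In each coordinate the bump on \<open>[A, A + t]\<close> equals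
  \<open>deriv \<eta> + I * \<psi>\<close>. Multiplying out, every \<open>deriv \<eta>\<close> is
  moved onto \<open>u\<close> as a weak derivative and leaves \<open>\<eta>\<close>, of size at most
  \<open>t * c\<close>; every other factor carries \<open>I\<close>, of size at most
  \<open>t\<close>. All four terms are therefore of order \<open>t^2\<close>. The constant
  \<open>M\<close> is fixed before the corner \<open>(A, B)\<close> and \<open>t\<close>, which
  makes the bound uniform.\<close>

lemma average_bound:
  assumes u: "H2 \<Omega> u" and h: "h > 0"
  shows "\<exists>M. \<forall>A B t. 0 < t \<longrightarrow> t < h / 2 \<longrightarrow> pgram A (A+h) B (B+h) \<subseteq> \<Omega> \<longrightarrow>
    \<bar>integral (pgram A (A+t) B (B+t)) (ext0 u)\<bar> \<le> M * t\<^sup>2"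
proof -
  obtain wd we wde where w: "integrable \<mu> wd" "integrable \<mu> we" "integrable \<mu> wde" and
    wd: "\<And>\<alpha> \<beta>. smooth1 \<alpha> \<Longrightarrow> smooth1 \<beta> \<Longrightarrow> test_fun \<Omega> (tensor \<alpha> \<beta>) \<Longrightarrow>
      integral\<^sup>L \<mu> (\<lambda>x. u x * tensor (deriv \<alpha>) \<beta> x) = - integral\<^sup>L \<mu> (\<lambda>x. wd x * tensor \<alpha> \<beta> x)" and
    we: "\<And>\<alpha> \<beta>. smooth1 \<alpha> \<Longrightarrow> smooth1 \<beta> \<Longrightarrow> test_fun \<Omega> (tensor \<alpha> \<beta>) \<Longrightarrow>
      integral\<^sup>L \<mu> (\<lambda>x. u x * tensor \<alpha> (deriv \<beta>) x) = - integral\<^sup>L \<mu> (\<lambda>x. we x * tensor \<alpha> \<beta> x)" and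
    wde: "\<And>\<alpha> \<beta>. smooth1 \<alpha> \<Longrightarrow> smooth1 \<beta> \<Longrightarrow> test_fun \<Omega> (tensor \<alpha> \<beta>) \<Longrightarrow>
      integral\<^sup>L \<mu> (\<lambda>x. u x * tensor (deriv \<alpha>) (deriv \<beta>) x) = integral\<^sup>L \<mu> (\<lambda>x. wde x * tensor \<alpha> \<beta> x)"
    using directional_weak_derivatives[OF u] by blast
  have Lu: "integrable \<mu> u" using u by (auto simp: H2_def H1_def intro: L2_integrable)
  have "h / 2 < h" using h by simp
  then obtain \<psi> K where \<psi>: "smooth1 \<psi>" "\<And>s. s \<notin> {h/2..h} \<Longrightarrow> \<psi> s = 0" "\<And>s. \<bar>\<psi> s\<bar> \<le> K"
    "(\<psi> has_integral 1) {h/2..h}"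
    by (rule normalized_bump) blast
  have K: "K \<ge> 0" using \<psi>(3)[of 0] by linarith
  define c where "c = 1 + h * K"
  have c: "c \<ge> 0" using h K by (simp add: c_def)
  let ?N = "\<lambda>w. integral\<^sup>L \<mu> (\<lambda>x. \<bar>w x\<bar>)"
  \<comment> \<open>One summand for each term of the expanded product: mixed derivative, derivative
    along \<open>d\<close>, derivative along \<open>e\<close>, and \<open>u\<close> itself.\<close>
  define M where "M = c * c * ?N wde + c * K * ?N wd + c * K * ?N we + K * K * ?N u"
  have "\<bar>integral (pgram A (A+t) B (B+t)) (ext0 u)\<bar> \<le> M * t\<^sup>2"
    if t: "0 < t" "t < h / 2" and sub: "pgram A (A+h) B (B+h) \<subseteq> \<Omega>" for A B t
  proof (rule integral_pgram_le[OF Lu])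
    show "pgram A (A+t) B (B+t) \<subseteq> \<Omega>" using sub t by (auto simp: pgram_def)
    fix n
    define \<beta> where "\<beta> A = bump A (A+t) n" for A
    have \<beta>: "smooth1 (\<beta> A)" "\<And>s. s \<notin> {A..A+t} \<Longrightarrow> \<beta> A s = 0" "\<And>s. 0 \<le> \<beta> A s" "\<And>s. \<beta> A s \<le> 1" for A
      by (auto simp: \<beta>_def smooth1_bump bump_nonneg bump_le_1 intro: bump_eq_0)
    obtain \<eta>1 I1 where \<eta>1: "smooth1 \<eta>1" "\<And>s. s \<notin> {A..A+h} \<Longrightarrow> \<eta>1 s = 0" "0 \<le> I1" "I1 \<le> t"
      "\<And>s. \<bar>\<eta>1 s\<bar> \<le> t * (1 + h * K)" "\<And>s. \<beta> A s = deriv \<eta>1 s + I1 * \<psi> (s - A)"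
      using ramp[OF t \<beta> \<psi>, of A] by blast
    obtain \<eta>2 I2 where \<eta>2: "smooth1 \<eta>2" "\<And>s. s \<notin> {B..B+h} \<Longrightarrow> \<eta>2 s = 0" "0 \<le> I2" "I2 \<le> t"
      "\<And>s. \<bar>\<eta>2 s\<bar> \<le> t * (1 + h * K)" "\<And>s. \<beta> B s = deriv \<eta>2 s + I2 * \<psi> (s - B)"
      using ramp[OF t \<beta> \<psi>, of B] by blast
    define \<psi>1 where "\<psi>1 s = \<psi> (s - A)" for s
    define \<psi>2 where "\<psi>2 s = \<psi> (s - B)" for s
    have sm: "smooth1 \<psi>1" "smooth1 \<psi>2"
      using smooth1_affine[OF \<psi>(1), of 1 "- A"] smooth1_affine[OF \<psi>(1), of 1 "- B"]
      by (simp_all add: \<psi>1_def[abs_def] \<psi>2_def[abs_def])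
    have sup: "\<psi>1 s = 0" if "s \<notin> {A..A+h}" for s using that \<psi>(2)[of "s - A"] h by (auto simp: \<psi>1_def)
    have sup': "\<psi>2 s = 0" if "s \<notin> {B..B+h}" for s using that \<psi>(2)[of "s - B"] h by (auto simp: \<psi>2_def)
    have \<psi>b: "\<bar>\<psi>1 s\<bar> \<le> K" "\<bar>\<psi>2 s\<bar> \<le> K" for s by (simp_all add: \<psi>1_def \<psi>2_def \<psi>(3))
    have \<eta>b: "\<bar>\<eta>1 s\<bar> \<le> t * c" "\<bar>\<eta>2 s\<bar> \<le> t * c" for s using \<eta>1(5) \<eta>2(5) by (simp_all add: c_def)
    have tf: "test_fun \<Omega> (tensor \<alpha> \<alpha>')" if "\<alpha> \<in> {\<eta>1, \<psi>1, deriv \<eta>1}" "\<alpha>' \<in> {\<eta>2, \<psi>2, deriv \<eta>2}" for \<alpha> \<alpha>'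
    proof (rule test_fun_tensor[OF _ _ sub])
      show "smooth1 \<alpha>" "smooth1 \<alpha>'" using that \<eta>1(1) \<eta>2(1) sm by (auto intro: smooth1_deriv)
      have d0: "deriv \<eta> s = 0" if "smooth1 \<eta>" "\<And>s. s \<notin> {P..P+h} \<Longrightarrow> \<eta> s = 0" "s \<notin> {P..P+h}" for \<eta> P s
      proof -
        have "((\<lambda>_. 0) has_real_derivative 0) (at s)" by simp
        then have "(\<eta> has_real_derivative 0) (at s)"
          by (rule has_field_derivative_transform_within_open[of _ _ _ "- {P..P+h}"]) (use that in auto)
        then show ?thesis by (rule DERIV_imp_deriv)
      qed
      show "\<alpha> s = 0" if "s \<notin> {A..A+h}" for s
        using that \<open>\<alpha> \<in> _\<close> \<eta>1(2)[of s] sup[of s] d0[of \<eta>1 A s] \<eta>1(1,2) by auto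
      show "\<alpha>' s = 0" if "s \<notin> {B..B+h}" for s
        using that \<open>\<alpha>' \<in> _\<close> \<eta>2(2)[of s] sup'[of s] d0[of \<eta>2 B s] \<eta>2(1,2) by auto
    qed
    note int = integrable_mult_test[OF Lu tf]
    have "u x * tensor (\<beta> A) (\<beta> B) x = u x * tensor (deriv \<eta>1) (deriv \<eta>2) x
        + I2 * (u x * tensor (deriv \<eta>1) \<psi>2 x) + I1 * (u x * tensor \<psi>1 (deriv \<eta>2) x)
        + I1 * I2 * (u x * tensor \<psi>1 \<psi>2 x)" for x
      by (simp add: tensor_def \<eta>1(6) \<eta>2(6) \<psi>1_def \<psi>2_def algebra_simps)
    then have "integral\<^sup>L \<mu> (\<lambda>x. u x * tensor (\<beta> A) (\<beta> B) x) =
        integral\<^sup>L \<mu> (\<lambda>x. u x * tensor (deriv \<eta>1) (deriv \<eta>2) x)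
        + I2 * integral\<^sup>L \<mu> (\<lambda>x. u x * tensor (deriv \<eta>1) \<psi>2 x)
        + I1 * integral\<^sup>L \<mu> (\<lambda>x. u x * tensor \<psi>1 (deriv \<eta>2) x)
        + I1 * I2 * integral\<^sup>L \<mu> (\<lambda>x. u x * tensor \<psi>1 \<psi>2 x)"
      using int by simp
    \<comment> \<open>One integration by parts changes the sign; the mixed term is integrated by
      parts twice and keeps it.\<close>
    also have "\<dots> = integral\<^sup>L \<mu> (\<lambda>x. wde x * tensor \<eta>1 \<eta>2 x)
        - I2 * integral\<^sup>L \<mu> (\<lambda>x. wd x * tensor \<eta>1 \<psi>2 x)
        - I1 * integral\<^sup>L \<mu> (\<lambda>x. we x * tensor \<psi>1 \<eta>2 x)
        + I1 * I2 * integral\<^sup>L \<mu> (\<lambda>x. u x * tensor \<psi>1 \<psi>2 x)"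
      using \<eta>1(1) \<eta>2(1) sm by (simp add: wde wd we tf)
    finally have eq: "integral\<^sup>L \<mu> (\<lambda>x. u x * tensor (\<beta> A) (\<beta> B) x) = \<dots>" .
    have le: "\<bar>integral\<^sup>L \<mu> (\<lambda>x. f x * tensor \<alpha> \<alpha>' x)\<bar> \<le> P * Q * ?N f"
      if "integrable \<mu> f" "\<alpha> \<in> {\<eta>1, \<psi>1, deriv \<eta>1}" "\<alpha>' \<in> {\<eta>2, \<psi>2, deriv \<eta>2}"
        "\<And>s. \<bar>\<alpha> s\<bar> \<le> P" "\<And>s. \<bar>\<alpha>' s\<bar> \<le> Q" for f \<alpha> \<alpha>' P Q
      using that by (intro integrable_mult_bounded(2) test_fun_measurable tf tensor_le)
    have 1: "\<bar>integral\<^sup>L \<mu> (\<lambda>x. wde x * tensor \<eta>1 \<eta>2 x)\<bar> \<le> (t * c) * (t * c) * ?N wde"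
      by (rule le) (use w \<eta>b in auto)
    have 2: "\<bar>I2 * integral\<^sup>L \<mu> (\<lambda>x. wd x * tensor \<eta>1 \<psi>2 x)\<bar> \<le> t * ((t * c) * K * ?N wd)"
      unfolding abs_mult using \<eta>2(3,4) t
      by (intro mult_mono le) (use w \<eta>b \<psi>b in auto)
    have 3: "\<bar>I1 * integral\<^sup>L \<mu> (\<lambda>x. we x * tensor \<psi>1 \<eta>2 x)\<bar> \<le> t * (K * (t * c) * ?N we)"
      unfolding abs_mult using \<eta>1(3,4) t
      by (intro mult_mono le) (use w \<eta>b \<psi>b in auto)
    have 4: "\<bar>I1 * I2 * integral\<^sup>L \<mu> (\<lambda>x. u x * tensor \<psi>1 \<psi>2 x)\<bar> \<le> t * t * (K * K * ?N u)"
      unfolding abs_mult using \<eta>1(3,4) \<eta>2(3,4) t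
      by (intro mult_mono le) (use Lu \<psi>b in auto)
    have "\<bar>integral\<^sup>L \<mu> (\<lambda>x. u x * tensor (\<beta> A) (\<beta> B) x)\<bar> \<le>
       (t * c) * (t * c) * ?N wde + t * ((t * c) * K * ?N wd) + t * (K * (t * c) * ?N we) + t * t * (K * K * ?N u)"
      unfolding eq using 1 2 3 4 by linarith
    also have "\<dots> = M * t\<^sup>2" by (simp add: M_def power2_eq_square algebra_simps)
    finally show "\<bar>integral\<^sup>L \<mu> (\<lambda>x. u x * tensor (bump A (A+t) n) (bump B (B+t) n) x)\<bar> \<le> M * t\<^sup>2"
      by (simp add: \<beta>_def)
  qed
  then show ?thesis by blast
qed

text \<open>The side length \<open>h\<close> must serve all corners in \<open>U\<close> at once;
  this is what yields a single constant from \<open>average_bound\<close>.\<close>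

lemma locally_bounded_AE:
  assumes u: "H2 \<Omega> u" and h: "h > 0"
    and U: "\<And>y. y \<in> U \<Longrightarrow> pgram (a \<bullet> y) (a \<bullet> y + h) (b \<bullet> y) (b \<bullet> y + h) \<subseteq> \<Omega>"
  shows "\<exists>M. AE x in \<mu>. x \<in> U \<longrightarrow> \<bar>u x\<bar> \<le> M"
proof -
  obtain M where M: "\<forall>A B t. 0 < t \<longrightarrow> t < h / 2 \<longrightarrow> pgram A (A+h) B (B+h) \<subseteq> \<Omega> \<longrightarrow>
    \<bar>integral (pgram A (A+t) B (B+t)) (ext0 u)\<bar> \<le> M * t\<^sup>2"
    using average_bound[OF u h] by blast
  have Lu: "integrable \<mu> u" using u by (auto simp: H2_def H1_def intro: L2_integrable)
  have "\<exists>\<delta>>0. \<forall>t. 0 < t \<and> t < \<delta> \<longrightarrow>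
      \<bar>integral (pgram (a \<bullet> y) (a \<bullet> y + t) (b \<bullet> y) (b \<bullet> y + t)) (ext0 u)\<bar> \<le> M * t\<^sup>2" if "y \<in> U" for y
    using M U[OF that] h by (intro exI[of _ "h/2"]) simp
  then obtain N where N: "negligible N" "\<And>x. x \<in> U \<Longrightarrow> x \<notin> N \<Longrightarrow> \<bar>ext0 u x\<bar> \<le> M / jac"
    using lebesgue_differentiation_bound[OF ext0_absolutely_integrable[OF Lu], of U M] by blast
  have "AE x in \<mu>. x \<in> U \<longrightarrow> \<bar>u x\<bar> \<le> M / jac"
  proof (rule AE_\<mu>I[OF N(1)], rule impI)
    fix x assume "x \<in> \<Omega>" "x \<notin> N" "x \<in> U"
    then show "\<bar>u x\<bar> \<le> M / jac" using N(2)[of x] by (simp add: ext0_def)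
  qed
  then show ?thesis by blast
qed

end

subsection \<open>Boundedness up to a Lipschitz boundary\<close>

text \<open>In rotated coordinates a point is \<open>s (1, -K) + t (-1, -K)\<close> with first entry
  \<open>s - t\<close> and second entry \<open>-K (s + t)\<close>. Solving for \<open>s\<close> and
  \<open>t\<close> gives the two dual vectors; \<open>inv R\<close> preserves inner products, so
  duality survives the rotation.\<close>

lemma dual_frame_cone:
  assumes R: "orthogonal_transformation (R :: real^2 \<Rightarrow> real^2)" and K: "K > 0"
  shows "dual_frame (inv R (vector [1/2, - (1 / (2*K))])) (inv R (vector [- (1/2), - (1 / (2*K))]))
    (inv R (vector [1, - K])) (inv R (vector [- 1, - K]))"
proof -
  let ?S = "inv R"
  have S: "orthogonal_transformation ?S" using R by (rule orthogonal_transformation_inv)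
  have RS: "R (?S z) = z" for z using R by (simp add: orthogonal_transformation_surj surj_f_inv_f)
  have SR: "?S (R z) = z" for z using R by (simp add: orthogonal_transformation_inj)
  have lin: "linear ?S" using S by (simp add: orthogonal_transformation_def)
  have inner: "?S x \<bullet> ?S y = x \<bullet> y" for x y using S by (simp add: orthogonal_transformation_def)
  have inner': "?S x \<bullet> y = x \<bullet> R y" for x y using inner[of x "R y"] SR by simp
  show ?thesis
  proof
    fix y
    let ?s = "vector [1/2, - (1 / (2*K))] \<bullet> R y" and ?t = "vector [- (1/2), - (1 / (2*K))] \<bullet> R y"
    have "R y = ?s *\<^sub>R vector [1, - K] + ?t *\<^sub>R vector [- 1, - K]"
      using K by (simp add: vec_eq_iff forall_2 inner_vec_def sum_2 field_simps)
    then have "?S (R y) = ?S (?s *\<^sub>R vector [1, - K] + ?t *\<^sub>R vector [- 1, - K])"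
      by (rule arg_cong)
    also have "\<dots> = ?s *\<^sub>R ?S (vector [1, - K]) + ?t *\<^sub>R ?S (vector [- 1, - K])"
      by (simp only: linear_add[OF lin] linear_cmul[OF lin])
    finally have "?S (R y) = ?s *\<^sub>R ?S (vector [1, - K]) + ?t *\<^sub>R ?S (vector [- 1, - K])" .
    then show "y = (?S (vector [1/2, - (1 / (2*K))]) \<bullet> y) *\<^sub>R ?S (vector [1, - K]) +
        (?S (vector [- (1/2), - (1 / (2*K))]) \<bullet> y) *\<^sub>R ?S (vector [- 1, - K])"
      by (simp add: SR inner')
  qed (simp_all only: inner, use K in \<open>simp_all add: inner_vec_def sum_2\<close>)
qed

context bounded_open begin

lemma bounded_near_interior:
  assumes u: "H2 \<Omega> u" and x0: "x0 \<in> \<Omega>"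
  shows "\<exists>r>0. \<exists>M. AE x in \<mu>. x \<in> ball x0 r \<longrightarrow> \<bar>u x\<bar> \<le> M"
proof -
  let ?a = "axis 1 1 :: real^2" and ?b = "axis 2 1 :: real^2"
  interpret std: framed_domain \<Omega> ?a ?b ?a ?b by (rule standard_framed_domain)
  obtain r where r: "r > 0" "ball x0 r \<subseteq> \<Omega>" using open_\<Omega> x0 open_contains_ball by blast
  have "\<exists>M. AE x in \<mu>. x \<in> ball x0 (r/2) \<longrightarrow> \<bar>u x\<bar> \<le> M"
  \<comment> \<open>Both axis vectors have norm 1, so points of the square lie within
    \<open>2 * r / 5\<close> of the corner; together with \<open>r / 2\<close> this is still below
    \<open>r\<close>.\<close>
  proof (rule std.locally_bounded_AE[OF u, of "r/5"])
    fix y assume y: "y \<in> ball x0 (r/2)"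
    show "std.pgram (?a \<bullet> y) (?a \<bullet> y + r/5) (?b \<bullet> y) (?b \<bullet> y + r/5) \<subseteq> \<Omega>"
    proof
      fix x assume "x \<in> std.pgram (?a \<bullet> y) (?a \<bullet> y + r/5) (?b \<bullet> y) (?b \<bullet> y + r/5)"
      from std.pgram_norm_le[OF this] have "dist x y \<le> 2 * r / 5" by (simp add: dist_norm)
      then have "dist x0 x < r" using y r(1) dist_triangle[of x0 x y] by (simp add: dist_commute)
      then show "x \<in> \<Omega>" using r(2) by auto
    qed
  qed (use r in simp)
  then show ?thesis using r(1) half_gt_zero by blast
qed

text \<open>Below the graph of an \<open>L\<close>-Lipschitz function one stays when moving in the directions
  \<open>(1, -(L+1))\<close> and \<open>(-1, -(L+1))\<close>.\<close>
lemma bounded_near_boundary: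
  assumes u: "H2 \<Omega> u" and lip: "lipschitz_boundary \<Omega>" and x0: "x0 \<in> frontier \<Omega>"
  shows "\<exists>r>0. \<exists>M. AE x in \<mu>. x \<in> ball x0 r \<longrightarrow> \<bar>u x\<bar> \<le> M"
proof -
  obtain r L \<gamma> and R :: "real^2 \<Rightarrow> real^2" where r: "r > 0" and R: "orthogonal_transformation R" and \<gamma>: "L-lipschitz_on UNIV \<gamma>"
    and eq: "\<Omega> \<inter> ball x0 r = {x \<in> ball x0 r. R (x - x0) $ 2 < \<gamma> (R (x - x0) $ 1)}"
    using bspec[OF lip[unfolded lipschitz_boundary_def] x0] by blast
  \<comment> \<open>\<open>K\<close> has to dominate \<open>L\<close> and be strictly positive, also
    when \<open>L = 0\<close>; otherwise the two directions would be parallel.\<close>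
  define K where "K = L + 1"
  have L: "L \<ge> 0" using \<gamma> by (rule lipschitz_on_nonneg)
  then have K: "K > 0" by (simp add: K_def)
  let ?d = "inv R (vector [1, - K])" and ?e = "inv R (vector [- 1, - K])"
  let ?a = "inv R (vector [1/2, - (1 / (2*K))])" and ?b = "inv R (vector [- (1/2), - (1 / (2*K))])"
  interpret fr: framed_domain \<Omega> ?a ?b ?d ?e
    using dual_frame_cone[OF R K] by (intro framed_domain.intro bounded_open_axioms)
  have RS: "R (inv R z) = z" for z using R by (simp add: orthogonal_transformation_surj surj_f_inv_f)
  have lin: "linear R" using R by (simp add: orthogonal_transformation_def)
  \<comment> \<open>With side \<open>h = r / (2 * c)\<close> a parallelogram reaches less than
    \<open>r / 2\<close> from its corner, so from the half ball it cannot leave the ball where the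
    graph description is valid. The summand 1 makes the estimate strict.\<close>
  define c where "c = norm ?d + norm ?e + 1"
  have c: "c > 0" by (simp add: c_def add_nonneg_pos)
  define h where "h = r / (2 * c)"
  have h: "h > 0" using r c by (simp add: h_def)
  have hc: "h * (norm ?d + norm ?e) < r / 2"
  proof -
    have "h * (norm ?d + norm ?e) < h * c" using h by (intro mult_strict_left_mono) (auto simp: c_def)
    also have "\<dots> = r / 2" using c by (simp add: h_def)
    finally show ?thesis .
  qed
  have "\<exists>M. AE x in \<mu>. x \<in> \<Omega> \<inter> ball x0 (r/2) \<longrightarrow> \<bar>u x\<bar> \<le> M"
  proof (rule fr.locally_bounded_AE[OF u h])
    fix y assume y: "y \<in> \<Omega> \<inter> ball x0 (r/2)"
    show "fr.pgram (?a \<bullet> y) (?a \<bullet> y + h) (?b \<bullet> y) (?b \<bullet> y + h) \<subseteq> \<Omega>"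
    proof
      fix x assume x: "x \<in> fr.pgram (?a \<bullet> y) (?a \<bullet> y + h) (?b \<bullet> y) (?b \<bullet> y + h)"
      have "dist x y < r / 2" using fr.pgram_norm_le[OF x] hc by (simp add: dist_norm)
      then have xr: "x \<in> ball x0 r" using y dist_triangle[of x0 x y] by (simp add: dist_commute)
      define s where "s = ?a \<bullet> (x - y)"
      define t where "t = ?b \<bullet> (x - y)"
      have st: "s \<ge> 0" "t \<ge> 0" using x by (auto simp: s_def t_def fr.pgram_def inner_diff_right)
      have "x - x0 = (y - x0) + (s *\<^sub>R ?d + t *\<^sub>R ?e)"
        using fr.expand[of "x - y"] by (simp add: s_def t_def algebra_simps)
      then have "R (x - x0) = R ((y - x0) + (s *\<^sub>R ?d + t *\<^sub>R ?e))"
        by (rule arg_cong)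
      also have "\<dots> = R (y - x0) + (s *\<^sub>R vector [1, - K] + t *\<^sub>R vector [- 1, - K])"
        by (simp only: linear_add[OF lin] linear_cmul[OF lin] RS)
      finally have "R (x - x0) = R (y - x0) + (s *\<^sub>R vector [1, - K] + t *\<^sub>R vector [- 1, - K])" .
      \<comment> \<open>The move shifts the first coordinate by \<open>s - t\<close> and lowers the
        second by \<open>K * (s + t)\<close>. The graph can drop by at most
        \<open>L * \<bar>s - t\<bar>\<close>, which is no more than \<open>K * (s + t)\<close>
        because \<open>s\<close> and \<open>t\<close> are nonnegative.\<close>
      then have R1: "R (x - x0) $ 1 = R (y - x0) $ 1 + (s - t)"
        and R2: "R (x - x0) $ 2 = R (y - x0) $ 2 - K * (s + t)"
        by (simp_all add: algebra_simps)
      have "y \<in> \<Omega> \<inter> ball x0 r" using y r by auto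
      then have "R (y - x0) $ 2 < \<gamma> (R (y - x0) $ 1)" using eq by blast
      also have "\<gamma> (R (y - x0) $ 1) \<le> \<gamma> (R (x - x0) $ 1) + L * \<bar>s - t\<bar>"
      proof -
        have "\<bar>\<gamma> (R (y - x0) $ 1) - \<gamma> (R (x - x0) $ 1)\<bar> \<le> L * \<bar>s - t\<bar>"
          using lipschitz_onD[OF \<gamma>, of "R (y - x0) $ 1" "R (x - x0) $ 1"]
          by (simp add: R1 dist_real_def abs_minus_commute)
        then show ?thesis by linarith
      qed
      also have "\<dots> \<le> \<gamma> (R (x - x0) $ 1) + K * (s + t)"
        using st L by (intro add_left_mono mult_mono) (auto simp: K_def)
      finally have "R (x - x0) $ 2 < \<gamma> (R (x - x0) $ 1)" using R2 by simp
      then show "x \<in> \<Omega>" using eq xr by blast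
    qed
  qed
  then obtain M where "AE x in \<mu>. x \<in> \<Omega> \<inter> ball x0 (r/2) \<longrightarrow> \<bar>u x\<bar> \<le> M" by blast
  then have "AE x in \<mu>. x \<in> ball x0 (r/2) \<longrightarrow> \<bar>u x\<bar> \<le> M"
    using AE_space by eventually_elim (auto simp: space_restrict_space)
  then show ?thesis using r half_gt_zero by blast
qed

text \<open>The local bounds, at interior points and at boundary points, are patched with a finite
  subcover of the compact closure; finitely many exceptional null sets stay null.\<close>

lemma H2_bounded:
  assumes u: "H2 \<Omega> u" and lip: "lipschitz_boundary \<Omega>"
  obtains M where "M > 0" "AE x in \<mu>. \<bar>u x\<bar> \<le> M"
proof -
  have "\<exists>r M. r > 0 \<and> (AE x in \<mu>. x \<in> ball x0 r \<longrightarrow> \<bar>u x\<bar> \<le> M)" if "x0 \<in> closure \<Omega>" for x0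
  proof (cases "x0 \<in> \<Omega>")
    case True
    from bounded_near_interior[OF u this] show ?thesis by auto
  next
    case False
    then have "x0 \<in> frontier \<Omega>" using that open_\<Omega> by (simp add: frontier_def interior_open)
    from bounded_near_boundary[OF u lip this] show ?thesis by auto
  qed
  then have "\<forall>x0\<in>closure \<Omega>. \<exists>r. r > 0 \<and> (\<exists>M. AE x in \<mu>. x \<in> ball x0 r \<longrightarrow> \<bar>u x\<bar> \<le> M)"
    by blast
  from bchoice[OF this] obtain r where r: "\<And>x0. x0 \<in> closure \<Omega> \<Longrightarrow> r x0 > 0"
    and "\<forall>x0\<in>closure \<Omega>. \<exists>M. AE x in \<mu>. x \<in> ball x0 (r x0) \<longrightarrow> \<bar>u x\<bar> \<le> M"
    by auto
  from bchoice[OF this(2)] obtain M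
    where M: "\<And>x0. x0 \<in> closure \<Omega> \<Longrightarrow> AE x in \<mu>. x \<in> ball x0 (r x0) \<longrightarrow> \<bar>u x\<bar> \<le> M x0"
    by auto
  have "compact (closure \<Omega>)" using bounded_\<Omega> by simp
  then obtain D where D: "D \<subseteq> closure \<Omega>" "finite D" "closure \<Omega> \<subseteq> (\<Union>c\<in>D. ball c (r c))"
    by (rule compactE_image[of "closure \<Omega>" "closure \<Omega>" "\<lambda>c. ball c (r c)"]) (use r in force)+
  have "AE x in \<mu>. \<forall>c\<in>D. x \<in> ball c (r c) \<longrightarrow> \<bar>u x\<bar> \<le> M c"
    using D M by (intro AE_finite_allI) auto
  \<comment> \<open>The sum stands in for a maximum over the finite cover, and the added 1 makes the
    bound strictly positive.\<close>
  then have "AE x in \<mu>. \<bar>u x\<bar> \<le> 1 + (\<Sum>c\<in>D. \<bar>M c\<bar>)"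
    using AE_space
  proof eventually_elim
    case (elim x)
    then have "x \<in> closure \<Omega>" using closure_subset by (auto simp: space_restrict_space)
    then obtain c where c: "c \<in> D" "x \<in> ball c (r c)" using D(3) by blast
    then have "\<bar>u x\<bar> \<le> \<bar>M c\<bar>" using elim by fastforce
    also have "\<dots> \<le> (\<Sum>c\<in>D. \<bar>M c\<bar>)" using c D(2) by (intro member_le_sum) auto
    finally show ?case by simp
  qed
  moreover have "1 + (\<Sum>c\<in>D. \<bar>M c\<bar>) > 0" by (intro add_pos_nonneg sum_nonneg) auto
  ultimately show thesis using that by blast
qed

end

subsection \<open>The functional along lines\<close>

text \<open>At 0 the difference quotient is \<open>sgn h * \<bar>h\<bar> powr (q - 1)\<close>, which
  vanishes in the limit exactly because the exponent \<open>q - 1\<close> is positive.\<close>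

lemma abs_powr_has_derivative:
  fixes q :: real
  assumes q: "q > 1"
  shows "((\<lambda>x. \<bar>x\<bar> powr q) has_real_derivative q * \<bar>x\<bar> powr (q - 1) * sgn x) (at x)"
proof (cases x "0::real" rule: linorder_cases)
  case equal
  have "((\<lambda>h::real. \<bar>h\<bar> powr (q - 1)) \<longlongrightarrow> \<bar>0\<bar> powr (q - 1)) (at 0)"
    using q by (intro tendsto_intros) auto
  then have "((\<lambda>h::real. \<bar>h\<bar> powr (q - 1)) \<longlongrightarrow> 0) (at 0)" using q by simp
  then have "((\<lambda>h::real. sgn h * \<bar>h\<bar> powr (q - 1)) \<longlongrightarrow> 0) (at 0)"
    by (rule Lim_null_comparison[rotated]) (auto simp: abs_mult sgn_if)
  then have "((\<lambda>h. (\<bar>0 + h\<bar> powr q - \<bar>0\<bar> powr q) / h) \<longlongrightarrow> 0) (at (0::real))"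
  proof (rule Lim_transform_eventually)
    have "sgn h * \<bar>h\<bar> powr (q - 1) = (\<bar>0 + h\<bar> powr q - \<bar>0\<bar> powr q) / h" if "h \<noteq> 0" for h :: real
      using that by (simp add: powr_diff sgn_if field_simps)
    then show "\<forall>\<^sub>F h in at 0. sgn h * \<bar>h\<bar> powr (q - 1) = (\<bar>0 + h\<bar> powr q - \<bar>0\<bar> powr q) / h"
      by (simp add: eventually_at_filter)
  qed
  then show ?thesis using equal by (simp add: DERIV_def)
next
  case greater
  have "((\<lambda>x. x powr q) has_real_derivative q * \<bar>x\<bar> powr (q - 1) * sgn x) (at x)"
    using has_real_derivative_powr[OF greater, of q] greater by simp
  then show ?thesis
    by (rule has_field_derivative_transform_within_open[of _ _ _ "{0<..}"]) (use greater in auto)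
next
  case less
  have "((\<lambda>x. (- x) powr q) has_real_derivative q * \<bar>x\<bar> powr (q - 1) * sgn x) (at x)"
    using less by (auto intro!: derivative_eq_intros)
  then show ?thesis
    by (rule has_field_derivative_transform_within_open[of _ _ _ "{..<0}"]) (use less in auto)
qed

text \<open>The mean value estimate on \<open>[-M, M]\<close>; it provides the integrable majorant
  for differentiating the power part under the integral.\<close>

lemma abs_powr_lipschitz:
  fixes q :: real
  assumes q: "q > 1" and "\<bar>x\<bar> \<le> M" "\<bar>y\<bar> \<le> M"
  shows "\<bar>\<bar>x\<bar> powr q - \<bar>y\<bar> powr q\<bar> \<le> q * M powr (q - 1) * \<bar>x - y\<bar>"
proof -
  have "norm (\<bar>x\<bar> powr q - \<bar>y\<bar> powr q) \<le> q * M powr (q - 1) * norm (x - y)"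
  proof (rule field_differentiable_bound[of "{- M..M}" "\<lambda>x. \<bar>x\<bar> powr q" "\<lambda>x. q * \<bar>x\<bar> powr (q - 1) * sgn x"])
    show "((\<lambda>x. \<bar>x\<bar> powr q) has_field_derivative q * \<bar>z\<bar> powr (q - 1) * sgn z) (at z within {- M..M})" for z
      using abs_powr_has_derivative[OF q] by (rule has_field_derivative_at_within)
    show "norm (q * \<bar>z\<bar> powr (q - 1) * sgn z) \<le> q * M powr (q - 1)" if "z \<in> {- M..M}" for z
    proof -
      have "\<bar>z\<bar> powr (q - 1) \<le> M powr (q - 1)" using that q by (intro powr_mono2) auto
      then show ?thesis using q by (auto simp: abs_mult sgn_if)
    qed
  qed (use assms in auto)
  then show ?thesis by simp
qed

text \<open>The scalar form of the Nehari argument: \<open>A\<close> and \<open>B\<close> are the quadratic and the power part of the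
  functional along a line, and \<open>\<tau> s\<close> is the factor projecting back to the Nehari manifold. The
  derivative of \<open>\<tau>\<close> drops out because \<open>\<tau> \<mapsto> \<tau>\<^sup>2 A 0 - \<tau> powr (p + 1) B 0\<close> is stationary at 1.\<close>
lemma nehari_projection:
  fixes A B :: "real \<Rightarrow> real"
  assumes p: "p > 1" and A: "(A has_real_derivative A') (at 0)" and B: "(B has_real_derivative B') (at 0)"
    and eq: "2 * A 0 = (p + 1) * B 0" and pos: "B 0 > 0"
    and min: "\<And>s \<tau>. \<tau> > 0 \<Longrightarrow> B s > 0 \<Longrightarrow> 2 * (\<tau>\<^sup>2 * A s) = (p + 1) * (\<tau> powr (p + 1) * B s) \<Longrightarrow>
      A 0 - B 0 \<le> \<tau>\<^sup>2 * A s - \<tau> powr (p + 1) * B s"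
  shows "A' = B'"
proof -
  \<comment> \<open>The scaled point satisfies the Nehari identity when
    \<open>2 * \<tau>^2 * A s = (p + 1) * \<tau> powr (p + 1) * B s\<close>. Dividing by
    \<open>\<tau>^2\<close> leaves \<open>\<tau> powr (p - 1) = \<rho> s\<close>, which explains
    both definitions.\<close>
  define \<rho> where "\<rho> s = 2 * A s / ((p + 1) * B s)" for s
  define \<tau> where "\<tau> s = \<rho> s powr (1 / (p - 1))" for s
  define F where "F s = (\<tau> s)\<^sup>2 * A s - \<tau> s powr (p + 1) * B s" for s
  \<comment> \<open>Positivity of the quadratic part at the minimiser is read off from the Nehari
    identity and the positive power part.\<close>
  have Apos: "A 0 > 0"
  proof -
    have "(p + 1) * B 0 > 0" using p pos by simp
    then show ?thesis using eq by linarith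
  qed
  have \<rho>0: "\<rho> 0 = 1" using eq p pos by (simp add: \<rho>_def)
  have \<tau>0: "\<tau> 0 = 1" by (simp add: \<tau>_def \<rho>0)
  have "(p + 1) * B 0 \<noteq> 0" using p pos by simp
  then have "\<exists>\<rho>'. (\<rho> has_real_derivative \<rho>') (at 0)"
    unfolding \<rho>_def by (auto intro!: exI derivative_eq_intros A B)
  then obtain \<rho>' where \<rho>': "(\<rho> has_real_derivative \<rho>') (at 0)" by blast
  have "\<exists>\<tau>'. (\<tau> has_real_derivative \<tau>') (at 0)"
    unfolding \<tau>_def using DERIV_fun_powr[OF \<rho>', of "1 / (p - 1)"] \<rho>0 by auto
  then obtain \<tau>' where \<tau>': "(\<tau> has_real_derivative \<tau>') (at 0)" by blast
  have "(F has_real_derivative (2 * \<tau>' * A 0 + A') - ((p + 1) * \<tau>' * B 0 + B')) (at 0)"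
  proof -
    have T: "((\<lambda>s. \<tau> s powr (p + 1)) has_real_derivative (p + 1) * \<tau>') (at 0)"
      using DERIV_fun_powr[OF \<tau>', of "p + 1"] \<tau>0 by simp
    have "((\<lambda>s. \<tau> s powr (p + 1) * B s) has_real_derivative (p + 1) * \<tau>' * B 0 + B') (at 0)"
      by (rule DERIV_cong[OF DERIV_mult[OF T B]]) (simp add: \<tau>0)
    moreover have "((\<lambda>s. (\<tau> s)\<^sup>2 * A s) has_real_derivative 2 * \<tau>' * A 0 + A') (at 0)"
      by (rule DERIV_cong[OF DERIV_mult[OF DERIV_power[OF \<tau>', of 2] A]]) (simp add: \<tau>0)
    ultimately show ?thesis unfolding F_def by (intro DERIV_diff)
  qed
  \<comment> \<open>The coefficient of the unknown \<open>\<tau>'\<close> is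
    \<open>2 * A 0 - (p + 1) * B 0\<close>, which is zero.\<close>
  moreover have "(2 * \<tau>' * A 0 + A') - ((p + 1) * \<tau>' * B 0 + B') = A' - B'"
  proof -
    have "2 * \<tau>' * A 0 = \<tau>' * (2 * A 0)" "(p + 1) * \<tau>' * B 0 = \<tau>' * ((p + 1) * B 0)" by simp_all
    then show ?thesis by (simp only: eq)
  qed
  ultimately have F': "(F has_real_derivative A' - B') (at 0)" by simp
  have "eventually (\<lambda>s. A s > 0) (nhds 0)" "eventually (\<lambda>s. B s > 0) (nhds 0)"
    using order_tendstoD(1)[OF DERIV_isCont[OF A, unfolded isCont_def] Apos]
      order_tendstoD(1)[OF DERIV_isCont[OF B, unfolded isCont_def] pos] Apos pos
    by (simp_all add: eventually_nhds_conv_at)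
  \<comment> \<open>Only near 0, where \<open>A s\<close> and \<open>B s\<close> are still positive,
    is \<open>\<tau> s\<close> a genuine positive projection factor; a local minimum of
    \<open>F\<close> is all that is used.\<close>
  then have "eventually (\<lambda>s. F 0 \<le> F s) (nhds 0)"
  proof eventually_elim
    case (elim s)
    have \<rho>: "\<rho> s > 0" using elim p by (simp add: \<rho>_def)
    then have \<tau>: "\<tau> s > 0" by (simp add: \<tau>_def)
    have "\<tau> s powr (p - 1) = \<rho> s" using \<rho> p by (simp add: \<tau>_def powr_powr)
    then have "\<tau> s powr (p + 1) = (\<tau> s)\<^sup>2 * \<rho> s"
      using \<tau> powr_add[of "\<tau> s" 2 "p - 1"] by (simp add: add.commute)
    then have "2 * ((\<tau> s)\<^sup>2 * A s) = (p + 1) * (\<tau> s powr (p + 1) * B s)"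
      using elim p by (simp add: \<rho>_def)
    from min[OF \<tau> elim(2) this] show ?case by (simp add: F_def \<tau>0)
  qed
  then obtain \<delta> where "\<delta> > 0" "\<And>s. dist s 0 < \<delta> \<Longrightarrow> F 0 \<le> F s"
    by (auto simp: eventually_nhds_metric)
  then have "A' - B' = 0"
    by (intro DERIV_local_min[OF F', of \<delta>]) (auto simp: dist_real_def)
  then show ?thesis by simp
qed

context bounded_open begin

section \<open>The quadratic part of the functional\<close>

definition pairing :: "pfun \<Rightarrow> pfun \<Rightarrow> real" where
  "pairing f h = integral\<^sup>L \<mu> (\<lambda>x. f x * h x)"

definition lap :: "pfun \<Rightarrow> pfun" where
  "lap u x = D2 \<Omega> u 1 1 x + D2 \<Omega> u 2 2 x"

text \<open>The decompositions of \<open>f\<close> and \<open>h\<close> are assumed only almost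
  everywhere, because this is how linearity of \<open>D2\<close> is available.\<close>

lemma pairing_lincomb:
  assumes L2: "L2 \<Omega> f1" "L2 \<Omega> f2" "L2 \<Omega> h1" "L2 \<Omega> h2" and m: "f \<in> borel_measurable \<mu>" "h \<in> borel_measurable \<mu>"
    and f: "AE x in \<mu>. f x = f1 x + c * f2 x" and h: "AE x in \<mu>. h x = h1 x + c * h2 x"
  shows "pairing f h = pairing f1 h1 + c * (pairing f1 h2 + pairing f2 h1) + c\<^sup>2 * pairing f2 h2"
proof -
  note int = L2_mult[OF L2(1) L2(3)] L2_mult[OF L2(1) L2(4)] L2_mult[OF L2(2) L2(3)] L2_mult[OF L2(2) L2(4)]
  have "pairing f h = integral\<^sup>L \<mu> (\<lambda>x. f1 x * h1 x + c * (f1 x * h2 x + f2 x * h1 x) + c\<^sup>2 * (f2 x * h2 x))"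
    unfolding pairing_def
  proof (rule integral_cong_AE)
    show "AE x in \<mu>. f x * h x = f1 x * h1 x + c * (f1 x * h2 x + f2 x * h1 x) + c\<^sup>2 * (f2 x * h2 x)"
      using f h by eventually_elim (simp add: power2_eq_square algebra_simps)
  qed (use m L2 in \<open>auto simp: L2_def\<close>)
  also have "\<dots> = pairing f1 h1 + c * (pairing f1 h2 + pairing f2 h1) + c\<^sup>2 * pairing f2 h2"
    using int by (simp add: pairing_def)
  finally show ?thesis .
qed

lemma L2_lap: "H2 \<Omega> u \<Longrightarrow> L2 \<Omega> (lap u)"
  using L2_lincomb[of "D2 \<Omega> u 1 1" "D2 \<Omega> u 2 2" 1] D2_spec(1)[of u] by (simp add: lap_def[abs_def])

text \<open>The symmetric bilinear form whose half on the diagonal is the quadratic part of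
  \<open>J\<close>; the bracket is the polarised Hessian determinant. The entries \<open>1 2\<close>
  and \<open>2 1\<close> stay separate, as in \<open>J\<close>, since \<open>D2\<close> chooses them
  independently.\<close>

definition bilin :: "real \<Rightarrow> pfun \<Rightarrow> pfun \<Rightarrow> real" where
  "bilin \<sigma> u v = pairing (lap u) (lap v) - (1 - \<sigma>) *
     (pairing (D2 \<Omega> u 1 1) (D2 \<Omega> v 2 2) + pairing (D2 \<Omega> v 1 1) (D2 \<Omega> u 2 2)
      - pairing (D2 \<Omega> u 1 2) (D2 \<Omega> v 2 1) - pairing (D2 \<Omega> v 1 2) (D2 \<Omega> u 2 1))"

lemma bilin_lincomb:
  assumes H2: "H2 \<Omega> u" "H2 \<Omega> v"
  shows "bilin \<sigma> (\<lambda>x. u x + c * v x) (\<lambda>x. u x + c * v x) / 2 =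
    bilin \<sigma> u u / 2 + c * bilin \<sigma> u v + c\<^sup>2 * (bilin \<sigma> v v / 2)"
proof -
  let ?w = "\<lambda>x. u x + c * v x"
  note D = D2_lincomb[OF H2, of c]
  note S = D2_spec(1)[OF H2(1)] D2_spec(1)[OF H2(2)] L2_lap[OF H2(1)] L2_lap[OF H2(2)]
  note m = L2_measurable[OF D2_spec(1)[OF H2_lincomb[OF H2, of c]]] L2_measurable[OF L2_lap[OF H2_lincomb[OF H2, of c]]]
  have "AE x in \<mu>. lap ?w x = lap u x + c * lap v x"
    using D[of 1 1] D[of 2 2] by eventually_elim (simp add: lap_def algebra_simps)
  from pairing_lincomb[OF S(3,4) S(3,4) m(2,2) this this]
  have 1: "pairing (lap ?w) (lap ?w) =
      pairing (lap u) (lap u) + c * (pairing (lap u) (lap v) + pairing (lap v) (lap u)) + c\<^sup>2 * pairing (lap v) (lap v)" .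
  have sym: "pairing (lap v) (lap u) = pairing (lap u) (lap v)" by (simp add: pairing_def mult.commute)
  have 2: "pairing (D2 \<Omega> ?w i j) (D2 \<Omega> ?w k l) = pairing (D2 \<Omega> u i j) (D2 \<Omega> u k l)
     + c * (pairing (D2 \<Omega> u i j) (D2 \<Omega> v k l) + pairing (D2 \<Omega> v i j) (D2 \<Omega> u k l))
     + c\<^sup>2 * pairing (D2 \<Omega> v i j) (D2 \<Omega> v k l)" for i j k l
    by (rule pairing_lincomb[OF S(1,2) S(1,2) m(1,1) D D])
  show ?thesis
    unfolding bilin_def 1 2 sym by (simp add: field_simps)
qed

section \<open>The power part of the functional\<close>

definition power_part :: "pfun \<Rightarrow> real \<Rightarrow> pfun \<Rightarrow> real" where
  "power_part g p u = integral\<^sup>L \<mu> (\<lambda>x. g x * \<bar>u x\<bar> powr (p + 1) / (p + 1))"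

lemma J_eq:
  assumes "H2 \<Omega> u"
  shows "J \<Omega> \<sigma> g p u = bilin \<sigma> u u / 2 - power_part g p u"
proof -
  note i = L2_mult[OF D2_spec(1)[OF assms, of 1 1] D2_spec(1)[OF assms, of 2 2]]
    L2_mult[OF D2_spec(1)[OF assms, of 1 2] D2_spec(1)[OF assms, of 2 1]]
  have 1: "integral\<^sup>L \<mu> (\<lambda>x. D2 \<Omega> u 1 1 x * D2 \<Omega> u 2 2 x - D2 \<Omega> u 1 2 x * D2 \<Omega> u 2 1 x)
     = pairing (D2 \<Omega> u 1 1) (D2 \<Omega> u 2 2) - pairing (D2 \<Omega> u 1 2) (D2 \<Omega> u 2 1)"
    using i by (simp add: pairing_def)
  have 2: "integral\<^sup>L \<mu> (\<lambda>x. (D2 \<Omega> u 1 1 x + D2 \<Omega> u 2 2 x)\<^sup>2 / 2) = pairing (lap u) (lap u) / 2"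
    by (simp add: pairing_def lap_def power2_eq_square)
  show ?thesis
    unfolding J_def bilin_def power_part_def 1 2 by (simp add: field_simps)
qed

lemma power_part_cmult:
  "power_part g p (\<lambda>x. c * u x) = \<bar>c\<bar> powr (p + 1) * power_part g p u"
proof -
  have "g x * \<bar>c * u x\<bar> powr (p + 1) / (p + 1) = \<bar>c\<bar> powr (p + 1) * (g x * \<bar>u x\<bar> powr (p + 1) / (p + 1))" for x
    by (simp add: abs_mult powr_mult)
  then show ?thesis by (simp only: power_part_def integral_mult_right_zero)
qed

lemma power_part_eq_0:
  assumes "AE x in \<mu>. u x = 0" 
  shows "power_part g p u = 0"
  unfolding power_part_def
  by (rule integral_eq_zero_AE) (use assms in eventually_elim, simp)

text \<open>With \<open>g\<close> merely integrable, it is the essential bound on \<open>u\<close>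
  that supplies a majorant, a constant multiple of \<open>g\<close>.\<close>

lemma power_part_integrable:
  fixes u g :: pfun
  assumes g: "integrable \<mu> g" and u: "u \<in> borel_measurable \<mu>" "AE x in \<mu>. \<bar>u x\<bar> \<le> M" and p: "p > 1"
  shows "integrable \<mu> (\<lambda>x. g x * \<bar>u x\<bar> powr (p + 1) / (p + 1))"
proof (rule Bochner_Integration.integrable_bound[where f="\<lambda>x. M powr (p + 1) / (p + 1) * g x"])
  show "integrable \<mu> (\<lambda>x. M powr (p + 1) / (p + 1) * g x)" using g by simp
  show "(\<lambda>x. g x * \<bar>u x\<bar> powr (p + 1) / (p + 1)) \<in> borel_measurable \<mu>"
  proof -
    have "(\<lambda>y. \<bar>y\<bar> powr (p + 1) :: real) \<in> borel_measurable borel" by measurable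
    from measurable_compose[OF u(1) this] show ?thesis
      by (intro borel_measurable_divide borel_measurable_times borel_measurable_integrable[OF g] borel_measurable_const)
  qed
  show "AE x in \<mu>. norm (g x * \<bar>u x\<bar> powr (p + 1) / (p + 1)) \<le> norm (M powr (p + 1) / (p + 1) * g x)"
    using u(2)
  proof eventually_elim
    case (elim x)
    then have "\<bar>u x\<bar> powr (p + 1) \<le> M powr (p + 1)" using p by (intro powr_mono2) auto
    then show ?case using p mult_right_mono[of "\<bar>u x\<bar> powr (p + 1)" "M powr (p + 1)" "\<bar>g x\<bar>"]
      by (simp add: abs_mult divide_right_mono mult.commute)
  qed
qed

text \<open>A vanishing integral of a nonnegative integrand forces the integrand, and since
  \<open>g > 0\<close> also \<open>u\<close>, to vanish almost everywhere. Integrability has to be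
  established first, because the integral of a non-integrable function is 0 by convention.\<close>

lemma power_part_pos:
  assumes g: "integrable \<mu> g" "AE x in \<mu>. g x > 0" and u: "u \<in> borel_measurable \<mu>" "AE x in \<mu>. \<bar>u x\<bar> \<le> M"
    and p: "p > 1" and nz: "\<not> (AE x in \<mu>. u x = 0)"
  shows "power_part g p u > 0"
proof -
  have nn: "AE x in \<mu>. 0 \<le> g x * \<bar>u x\<bar> powr (p + 1) / (p + 1)"
    using g(2) by eventually_elim (use p in auto)
  have "power_part g p u \<noteq> 0"
  proof
    assume "power_part g p u = 0"
    then have "AE x in \<mu>. g x * \<bar>u x\<bar> powr (p + 1) / (p + 1) = 0"
      unfolding power_part_def
      using integral_nonneg_eq_0_iff_AE[OF power_part_integrable[OF g(1) u p] nn] by simp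
    then have "AE x in \<mu>. u x = 0"
      using g(2) by eventually_elim (use p in auto)
    then show False using nz by simp
  qed
  moreover have "power_part g p u \<ge> 0" unfolding power_part_def using nn by (rule integral_nonneg_AE)
  ultimately show ?thesis by simp
qed

text \<open>Differentiation under the integral sign by dominated convergence along sequences tending
  to 0, with a constant multiple of \<open>\<bar>g x\<bar>\<close> as majorant of the difference
  quotients.\<close>

lemma power_part_differentiable:
  assumes g: "integrable \<mu> g" and u: "u \<in> borel_measurable \<mu>" "AE x in \<mu>. \<bar>u x\<bar> \<le> M"
    and v: "v \<in> borel_measurable \<mu>" "AE x in \<mu>. \<bar>v x\<bar> \<le> M'" and p: "p > 1" and M': "M' \<ge> 0"
  shows "\<exists>D. ((\<lambda>t. power_part g p (\<lambda>x. u x + t * v x)) has_real_derivative D) (at 0)"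
proof -
  define \<phi> where "\<phi> y = \<bar>y\<bar> powr (p + 1)" for y :: real
  define \<phi>' where "\<phi>' y = (p + 1) * \<bar>y\<bar> powr p * sgn y" for y :: real
  have \<phi>': "(\<phi> has_real_derivative \<phi>' y) (at y)" for y
    using abs_powr_has_derivative[of "p + 1" y] p by (simp add: \<phi>_def[abs_def] \<phi>'_def)
  \<comment> \<open>The Lipschitz constant of \<open>\<phi>\<close> on the interval of radius
    \<open>M + M'\<close>, which contains \<open>u x + t * v x\<close> for almost every
    \<open>x\<close> as long as \<open>\<bar>t\<bar> \<le> 1\<close>.\<close>
  define c where "c = (p + 1) * (M + M') powr p"
  let ?f = "\<lambda>t x. g x * \<phi> (u x + t * v x) / (p + 1)"
  let ?D = "integral\<^sup>L \<mu> (\<lambda>x. g x * (\<phi>' (u x) * v x) / (p + 1))"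
  have int: "integrable \<mu> (?f t)" for t
  proof -
    have "AE x in \<mu>. \<bar>u x + t * v x\<bar> \<le> M + \<bar>t\<bar> * M'"
      using u(2) v(2)
    proof eventually_elim
      case (elim x)
      have "\<bar>u x + t * v x\<bar> \<le> \<bar>u x\<bar> + \<bar>t\<bar> * \<bar>v x\<bar>" using abs_triangle_ineq[of "u x" "t * v x"] by (simp add: abs_mult)
      also have "\<dots> \<le> M + \<bar>t\<bar> * M'" using elim by (intro add_mono mult_left_mono) auto
      finally show ?case .
    qed
    then show ?thesis unfolding \<phi>_def using g u v p by (intro power_part_integrable) auto
  qed
  have "((\<lambda>t. (integral\<^sup>L \<mu> (?f t) - integral\<^sup>L \<mu> (?f 0)) / (t - 0)) \<longlongrightarrow> ?D) (at 0)"
    unfolding tendsto_at_iff_sequentially comp_def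
  proof (intro allI impI)
    fix X :: "nat \<Rightarrow> real" assume X: "\<forall>i. X i \<in> UNIV - {0}" "X \<longlonglongrightarrow> 0"
    have X0: "X n \<noteq> 0" for n using X(1) by auto
    \<comment> \<open>The majorant has to hold for every index, so the sequence is shifted past
      \<open>n0\<close>; the shift is undone at the end by \<open>LIMSEQ_offset\<close>.\<close>
    have "eventually (\<lambda>n. \<bar>X n\<bar> \<le> 1) sequentially"
      using tendsto_rabs[OF X(2)] by (auto elim!: order_tendstoD(2)[of _ _ _ 1, THEN eventually_mono] )
    then obtain n0 where n0: "\<And>n. n \<ge> n0 \<Longrightarrow> \<bar>X n\<bar> \<le> 1" by (auto simp: eventually_sequentially)
    have "(\<lambda>n. integral\<^sup>L \<mu> (\<lambda>x. (?f (X (n + n0)) x - ?f 0 x) / X (n + n0))) \<longlonglongrightarrow> ?D"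
    proof (rule integral_dominated_convergence[where w="\<lambda>x. c * M' / (p + 1) * \<bar>g x\<bar>"])
      have \<phi>m: "\<phi>' \<in> borel_measurable borel" unfolding \<phi>'_def by measurable
      show "(\<lambda>x. g x * (\<phi>' (u x) * v x) / (p + 1)) \<in> borel_measurable \<mu>"
        using borel_measurable_integrable[OF g] v measurable_compose[OF u(1) \<phi>m] by measurable
      show "(\<lambda>x. (?f (X (n + n0)) x - ?f 0 x) / X (n + n0)) \<in> borel_measurable \<mu>" for n
        by (intro borel_measurable_divide borel_measurable_diff borel_measurable_integrable[OF int] borel_measurable_const)
      show "integrable \<mu> (\<lambda>x. c * M' / (p + 1) * \<bar>g x\<bar>)" using g by auto
      show "AE x in \<mu>. (\<lambda>n. (?f (X (n + n0)) x - ?f 0 x) / X (n + n0)) \<longlonglongrightarrow> g x * (\<phi>' (u x) * v x) / (p + 1)"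
      proof (rule AE_I2)
        fix x
        have "((\<lambda>t. ?f t x) has_real_derivative g x * (\<phi>' (u x) * v x) / (p + 1)) (at 0)"
        proof -
          have "((\<lambda>t. u x + t * v x) has_real_derivative v x) (at 0)"
            by (auto intro!: derivative_eq_intros)
          from DERIV_chain2[OF _ this, of \<phi> "\<phi>' (u x)"] \<phi>'[of "u x"]
          have "((\<lambda>t. \<phi> (u x + t * v x)) has_real_derivative \<phi>' (u x) * v x) (at 0)" by simp
          from DERIV_cdivide[OF DERIV_cmult[OF this]] show ?thesis .
        qed
        then have "((\<lambda>t. (?f t x - ?f 0 x) / (t - 0)) \<longlongrightarrow> g x * (\<phi>' (u x) * v x) / (p + 1)) (at 0)"
          by (simp add: has_field_derivative_iff)
        then have "((\<lambda>t. (?f t x - ?f 0 x) / (t - 0)) \<circ> (\<lambda>n. X (n + n0))) \<longlonglongrightarrow> g x * (\<phi>' (u x) * v x) / (p + 1)"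
          using X0 LIMSEQ_ignore_initial_segment[OF X(2), of n0]
          unfolding tendsto_at_iff_sequentially by simp
        then show "(\<lambda>n. (?f (X (n + n0)) x - ?f 0 x) / X (n + n0)) \<longlonglongrightarrow> g x * (\<phi>' (u x) * v x) / (p + 1)"
          by (simp add: comp_def)
      qed
      show "AE x in \<mu>. norm ((?f (X (n + n0)) x - ?f 0 x) / X (n + n0)) \<le> c * M' / (p + 1) * \<bar>g x\<bar>" for n
        using u(2) v(2)
      proof eventually_elim
        case (elim x)
        let ?t = "X (n + n0)"
        have t1: "\<bar>?t\<bar> \<le> 1" using n0[of "n + n0"] by simp
        have "\<bar>u x + ?t * v x\<bar> \<le> \<bar>u x\<bar> + \<bar>?t\<bar> * \<bar>v x\<bar>" using abs_triangle_ineq[of "u x" "?t * v x"] by (simp add: abs_mult)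
        also have "\<dots> \<le> M + 1 * M'" using elim t1 by (intro add_mono mult_mono) auto
        finally have "\<bar>\<phi> (u x + ?t * v x) - \<phi> (u x)\<bar> \<le> c * \<bar>?t * v x\<bar>"
          using abs_powr_lipschitz[of "p + 1" "u x + ?t * v x" "M + M'" "u x"] elim M' p
          by (simp add: \<phi>_def c_def)
        also have "\<dots> \<le> c * (\<bar>?t\<bar> * M')"
          unfolding abs_mult using elim p by (intro mult_left_mono) (auto simp: c_def)
        finally have *: "\<bar>\<phi> (u x + ?t * v x) - \<phi> (u x)\<bar> / \<bar>?t\<bar> \<le> c * M'"
          using X0[of "n + n0"] by (simp add: field_simps)
        have "norm ((?f ?t x - ?f 0 x) / ?t) = \<bar>g x\<bar> / (p + 1) * (\<bar>\<phi> (u x + ?t * v x) - \<phi> (u x)\<bar> / \<bar>?t\<bar>)"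
          using p by (simp add: abs_mult flip: diff_divide_distrib right_diff_distrib)
        also have "\<dots> \<le> \<bar>g x\<bar> / (p + 1) * (c * M')"
          using * p by (intro mult_left_mono) auto
        finally show ?case by (simp add: mult_ac)
      qed
    qed
    then have "(\<lambda>n. (integral\<^sup>L \<mu> (?f (X (n + n0))) - integral\<^sup>L \<mu> (?f 0)) / X (n + n0)) \<longlonglongrightarrow> ?D"
      by (simp only: integral_divide_zero Bochner_Integration.integral_diff[OF int int])
    then show "(\<lambda>n. (integral\<^sup>L \<mu> (?f (X n)) - integral\<^sup>L \<mu> (?f 0)) / (X n - 0)) \<longlonglongrightarrow> ?D"
      using LIMSEQ_offset[of "\<lambda>n. (integral\<^sup>L \<mu> (?f (X n)) - integral\<^sup>L \<mu> (?f 0)) / X n" n0] by simp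
  qed
  then have "((\<lambda>t. integral\<^sup>L \<mu> (?f t)) has_real_derivative ?D) (at 0)"
    by (simp add: has_field_derivative_iff)
  then show ?thesis unfolding power_part_def \<phi>_def by blast
qed

section \<open>Scaling and the derivative along rays\<close>

lemma Xsp_H2: "u \<in> Xsp \<Omega> \<Longrightarrow> H2 \<Omega> u"
  by (simp add: Xsp_def)

text \<open>Scaling is the linear combination \<open>u + (c - 1) * u\<close>;
  \<open>bilin_cmult\<close> uses the same device, with
  \<open>1 + 2 (c - 1) + (c - 1)^2 = c^2\<close>.\<close>

lemma Xsp_cmult: "u \<in> Xsp \<Omega> \<Longrightarrow> (\<lambda>x. c * u x) \<in> Xsp \<Omega>"
  using Xsp_lincomb[of u u "c - 1"] by (simp add: algebra_simps)

lemma bilin_cmult: "H2 \<Omega> u \<Longrightarrow> bilin \<sigma> (\<lambda>x. c * u x) (\<lambda>x. c * u x) = c\<^sup>2 * bilin \<sigma> u u"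
  using bilin_lincomb[of u u \<sigma> "c - 1"] by (simp add: power2_eq_square algebra_simps)

text \<open>Along its own ray the functional is an explicit function of \<open>1 + t\<close> by
  homogeneity, so its derivative at 0 is known. Membership in the Nehari manifold thereby becomes an
  algebraic identity that a rescaled function can be checked against.\<close>

lemma dJ_zero_radial:
  assumes u: "u \<in> Xsp \<Omega>" and p: "p > 1"
  shows "dJ_zero \<Omega> \<sigma> g p u u \<longleftrightarrow> bilin \<sigma> u u = (p + 1) * power_part g p u"
proof -
  have J: "J \<Omega> \<sigma> g p (\<lambda>x. u x + t * u x) = (1 + t)\<^sup>2 * (bilin \<sigma> u u / 2) - \<bar>1 + t\<bar> powr (p + 1) * power_part g p u" for t
  proof -
    have "(\<lambda>x. u x + t * u x) = (\<lambda>x. (1 + t) * u x)" by (simp add: algebra_simps)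
    then show ?thesis
      using J_eq[OF Xsp_H2[OF Xsp_cmult[OF u]], of \<sigma> g p "1 + t"] bilin_cmult[OF Xsp_H2[OF u]]
      by (simp add: power_part_cmult)
  qed
  have P: "((\<lambda>t. \<bar>1 + t\<bar> powr (p + 1)) has_real_derivative (p + 1)) (at 0)"
  proof -
    have "((\<lambda>y. \<bar>y\<bar> powr (p + 1)) has_real_derivative (p + 1)) (at (1 + 0))"
      using abs_powr_has_derivative[of "p + 1" 1] p by simp
    moreover have "((\<lambda>t::real. 1 + t) has_real_derivative 1) (at 0)"
      by (auto intro!: derivative_eq_intros)
    ultimately show ?thesis
      using DERIV_chain2[of "\<lambda>y. \<bar>y\<bar> powr (p + 1)" "p + 1" "\<lambda>t. 1 + t" 0 1 UNIV] by simp
  qed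
  have "((\<lambda>t. J \<Omega> \<sigma> g p (\<lambda>x. u x + t * u x)) has_real_derivative
      bilin \<sigma> u u - (p + 1) * power_part g p u) (at 0)"
  proof -
    have "((\<lambda>t. (1 + t)\<^sup>2 * (bilin \<sigma> u u / 2)) has_real_derivative bilin \<sigma> u u) (at 0)"
      by (auto intro!: derivative_eq_intros)
    from DERIV_diff[OF this DERIV_cmult_right[OF P, of "power_part g p u"]] show ?thesis
      unfolding J .
  qed
  then show ?thesis
    unfolding dJ_zero_def using DERIV_unique by fastforce
qed

end

theorem theorem3p6:
  fixes \<Omega> :: "(real^2) set" and \<sigma> p :: real and g u :: "real^2 \<Rightarrow> real"
  assumes "open \<Omega>" and "connected \<Omega>" and "bounded \<Omega>" and "\<Omega> \<noteq> {}"
    and "lipschitz_boundary \<Omega>"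
    and "-1 < \<sigma>" and "\<sigma> \<le> 1"
    and "\<sigma> = 1 \<Longrightarrow> uniform_ext_ball \<Omega>"
    and "p > 1"
    and "g \<in> borel_measurable (lebesgue_on \<Omega>)" and "integrable (lebesgue_on \<Omega>) g"
    and "AE x in lebesgue_on \<Omega>. g x > 0"
    and "u \<in> Nehari \<Omega> \<sigma> g p"
    and "\<forall>v\<in>Nehari \<Omega> \<sigma> g p. J \<Omega> \<sigma> g p u \<le> J \<Omega> \<sigma> g p v"
  shows "critical_point \<Omega> \<sigma> g p u"
proof -
  interpret bounded_open \<Omega> using assms by unfold_locales
  note p = \<open>p > 1\<close> and g = \<open>integrable \<mu> g\<close> and gpos = \<open>AE x in \<mu>. g x > 0\<close>
  have u: "u \<in> Xsp \<Omega>" and unz: "\<not> (AE x in \<mu>. u x = 0)" and uN: "bilin \<sigma> u u = (p + 1) * power_part g p u"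
    using assms(13) dJ_zero_radial[OF _ p, of u \<sigma> g] by (auto simp: Nehari_def)
  have meas: "w \<in> borel_measurable \<mu>" if "w \<in> Xsp \<Omega>" for w
    using that by (auto simp: Xsp_def H2_def H1_def L2_def)
  have bdd: "\<exists>M>0. AE x in \<mu>. \<bar>w x\<bar> \<le> M" if "w \<in> Xsp \<Omega>" for w
    using H2_bounded[OF Xsp_H2[OF that] assms(5)] by metis
  obtain M where M: "M > 0" "AE x in \<mu>. \<bar>u x\<bar> \<le> M" using bdd[OF u] by blast
  have "dJ_zero \<Omega> \<sigma> g p u v" if v: "v \<in> Xsp \<Omega>" for v
  proof -
    let ?w = "\<lambda>s x. u x + s * v x"
    have w: "?w s \<in> Xsp \<Omega>" for s using u v by (rule Xsp_lincomb)
    \<comment> \<open>The quadratic and the power part of \<open>J\<close> along the line through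
      \<open>u\<close> in direction \<open>v\<close>; \<open>A\<close> is a polynomial in
      \<open>s\<close> of degree at most two.\<close>
    define A where "A s = bilin \<sigma> (?w s) (?w s) / 2" for s
    define B where "B s = power_part g p (?w s)" for s
    have A_eq: "A = (\<lambda>s. bilin \<sigma> u u / 2 + s * bilin \<sigma> u v + s\<^sup>2 * (bilin \<sigma> v v / 2))"
      unfolding A_def using bilin_lincomb[OF Xsp_H2[OF u] Xsp_H2[OF v]] by blast
    have A': "(A has_real_derivative bilin \<sigma> u v) (at 0)"
      unfolding A_eq by (auto intro!: derivative_eq_intros)
    obtain M' where M': "M' > 0" "AE x in \<mu>. \<bar>v x\<bar> \<le> M'" using bdd[OF v] by blast
    obtain B' where B': "(B has_real_derivative B') (at 0)"
      using power_part_differentiable[OF g meas[OF u] M(2) meas[OF v] M'(2) p] M'(1)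
      unfolding B_def by auto
    have J: "J \<Omega> \<sigma> g p (?w s) = A s - B s" for s
      using J_eq[OF Xsp_H2[OF w]] by (simp add: A_def B_def)
    have "bilin \<sigma> u v = B'"
    proof (rule nehari_projection[OF p A' B'])
      show "2 * A 0 = (p + 1) * B 0" using uN by (simp add: A_def B_def)
      show "B 0 > 0" using power_part_pos[OF g gpos meas[OF u] M(2) p unz] by (simp add: B_def)
      fix s \<tau> :: real
      assume \<tau>: "\<tau> > 0" and Bs: "B s > 0" and eq: "2 * (\<tau>\<^sup>2 * A s) = (p + 1) * (\<tau> powr (p + 1) * B s)"
      let ?z = "\<lambda>x. \<tau> * ?w s x"
      have z: "?z \<in> Xsp \<Omega>" using w by (rule Xsp_cmult)
      have bz: "bilin \<sigma> ?z ?z = 2 * (\<tau>\<^sup>2 * A s)"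
        using bilin_cmult[OF Xsp_H2[OF w]] by (simp add: A_def)
      have pz: "power_part g p ?z = \<tau> powr (p + 1) * B s"
        using \<tau> by (simp only: power_part_cmult B_def abs_of_pos)
      \<comment> \<open>The projected function has positive power part, so it is not zero almost
        everywhere and qualifies for the Nehari manifold.\<close>
      have "\<tau> powr (p + 1) * B s > 0" using \<tau> Bs by simp
      then have "\<not> (AE x in \<mu>. ?z x = 0)"
        using power_part_eq_0[of ?z g p] pz by auto
      moreover have "dJ_zero \<Omega> \<sigma> g p ?z ?z"
        using eq by (simp only: dJ_zero_radial[OF z p] bz pz)
      ultimately have "?z \<in> Nehari \<Omega> \<sigma> g p" using z by (simp add: Nehari_def)
      then have "J \<Omega> \<sigma> g p u \<le> J \<Omega> \<sigma> g p ?z" using assms(14) by blast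
      then show "A 0 - B 0 \<le> \<tau>\<^sup>2 * A s - \<tau> powr (p + 1) * B s"
        using J[of 0] J_eq[OF Xsp_H2[OF z], of \<sigma> g p] by (simp add: bz pz)
    qed
    \<comment> \<open>The derivative of \<open>J\<close> along \<open>v\<close> is
      \<open>bilin \<sigma> u v - B'\<close>, and the two terms have just been shown to
      agree.\<close>
    then show ?thesis
      unfolding dJ_zero_def J using DERIV_diff[OF A' B'] by simp
  qed
  then show ?thesis using u by (simp add: critical_point_def)
qed

end
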